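(* There exist a real number $\eta>0$, a positive integer $L_0$ (depending on $\eta$) and a real number $b>0$ such that for every integer $L>L_0$, if $\sigma$ is a linear ordering of $[L]=\{0,1,\ldots,L-1\}$ chosen uniformly at random among the $L!$ linear orderings, then $$\mathbb{P}\left(\text{there exists } U\subset[L]\text{ with } L/3\le |U|\le 2L/3 \text{ and } |\partial_{H_\sigma}U|<\eta L\right)<e^{-bL}.$$ In particular, there are a fixed $\eta>0$ and a constant $c_\eta>0$ such that for all sufficiently large $L$ there exist linear orderings $\sigma_L$ of $[L]$ whose path-pair multigraphs $H_{\sigma_L}$ satisfy $\operatorname{cr}(H_{\sigma_L})\ge c_\eta L^2$. Moreover, for a uniformly random linear ordering $\sigma$ of $[L]$, the probability that $\operatorname{cr}(H_{\sigma})\ge c_\eta L^2$ tends to $1$ as $L\to\infty$.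
   Context: A linear ordering $\sigma$ of $[L]=\{0,1,\ldots,L-1\}$ is a listing $(\sigma_0,\sigma_1,\ldots,\sigma_{L-1})$ of all the elements of $[L]$. For $L\ge 2$, the path-pair multigraph $H_\sigma$ is the multigraph on vertex set $[L]$ formed as the union (with multiplicity of edges) of the two Hamiltonian paths $P_0=(0,1,\ldots,L-1)$ and $P_\sigma=(\sigma_0,\sigma_1,\ldots,\sigma_{L-1})$. For a finite multigraph $H$ and $U\subseteq V(H)$, $\partial_H U$ is the multiset of edges of $H$ with exactly one endpoint in $U$. Drawings: in a drawing of a multigraph in the plane, vertices are distinct points, edges are simple arcs, no edge passes through a non-incident vertex, crossings are transverse interior intersections of two distinct edges, and there are no triple crossings; parallel edges are allowed and drawn as distinct arcs. The crossing number $\operatorname{cr}(H)$ is the minimum number of crossings among all such drawings of $H$ (edges meeting at shared endpoints are not counted as crossings). *)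

theory Defs
  imports "HOL-Probability.Probability" "HOL-Combinatorics.Multiset_Permutations"
begin

text \<open>
  Edges of a multigraph are identifiers; parallel edges are distinct identifiers with the same
  set of endpoints, so cardinalities of sets of edges count multiplicity.
\<close>

record ('v, 'e) multigraph =
  verts :: "'v set"
  edges :: "'e set"
  ends :: "'e \<Rightarrow> 'v set"

definition edge_boundary :: "('v, 'e) multigraph \<Rightarrow> 'v set \<Rightarrow> 'e set" where
  "edge_boundary H U = {e \<in> edges H. \<exists>u v. ends H e = {u, v} \<and> u \<in> U \<and> v \<notin> U}"

text \<open>
  A linear ordering of \<open>{..<L}\<close> is a list \<open>\<sigma> \<in> permutations_of_set {..<L}\<close>, and then
  \<open>length \<sigma> = L\<close>. The edges \<open>Inl i\<close> form the path \<open>0, 1, \<dots>, L - 1\<close> and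
  the edges \<open>Inr i\<close> form the path through \<open>\<sigma> ! 0, \<sigma> ! 1, \<dots>, \<sigma> ! (L - 1)\<close>.
\<close>

definition path_pair :: "nat list \<Rightarrow> (nat, nat + nat) multigraph" where
  "path_pair \<sigma> =
    \<lparr> verts = {..<length \<sigma>},
      edges = {..<length \<sigma> - 1} <+> {..<length \<sigma> - 1},
      ends = case_sum (\<lambda>i. {i, Suc i}) (\<lambda>i. {\<sigma> ! i, \<sigma> ! Suc i}) \<rparr>"

text \<open>
  Arcs are only assumed continuous, so transversality is topological: near \<open>x\<close>, some
  homeomorphism takes the two sets to two perpendicular diameters of a disc.
\<close>

definition transverse_at :: "complex \<Rightarrow> complex set \<Rightarrow> complex set \<Rightarrow> bool" where
  "transverse_at x A B \<longleftrightarrow>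
    (\<exists>W h k. open W \<and> x \<in> W \<and> homeomorphism W (ball 0 1) h k \<and> h x = 0 \<and>
       h ` (W \<inter> A) = {z \<in> ball 0 1. Im z = 0} \<and>
       h ` (W \<inter> B) = {z \<in> ball 0 1. Re z = 0})"

definition crossings ::
    "('v, 'e) multigraph \<Rightarrow> ('v \<Rightarrow> complex) \<Rightarrow> ('e \<Rightarrow> real \<Rightarrow> complex) \<Rightarrow> complex set" where
  "crossings H p \<gamma> =
    {x. x \<notin> p ` verts H \<and>
        (\<exists>e\<in>edges H. \<exists>f\<in>edges H. e \<noteq> f \<and> x \<in> path_image (\<gamma> e) \<inter> path_image (\<gamma> f))}"

text \<open>
  The vertex \<open>v\<close> is drawn at \<open>p v\<close> and the edge \<open>e\<close> as \<open>\<gamma> e\<close>, in either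
  direction. The drawings excluded by the finiteness condition (crossings accumulating at a common
  endpoint) have infinitely many crossings; the condition is needed since \<open>card\<close> is 0 on
  infinite sets. Since at most two edges pass through a crossing, counting points
  counts crossing pairs of edges with multiplicity.
\<close>

definition is_drawing ::
    "('v, 'e) multigraph \<Rightarrow> ('v \<Rightarrow> complex) \<Rightarrow> ('e \<Rightarrow> real \<Rightarrow> complex) \<Rightarrow> bool" where
  "is_drawing H p \<gamma> \<longleftrightarrow>
    inj_on p (verts H) \<and>
    (\<forall>e\<in>edges H. arc (\<gamma> e) \<and> {pathstart (\<gamma> e), pathfinish (\<gamma> e)} = p ` ends H e) \<and>
    (\<forall>e\<in>edges H. \<forall>v\<in>verts H. v \<notin> ends H e \<longrightarrow> p v \<notin> path_image (\<gamma> e)) \<and>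
    (\<forall>e\<in>edges H. \<forall>f\<in>edges H. e \<noteq> f \<longrightarrow>
       (\<forall>x \<in> path_image (\<gamma> e) \<inter> path_image (\<gamma> f) - p ` verts H.
          transverse_at x (path_image (\<gamma> e)) (path_image (\<gamma> f)))) \<and>
    (\<forall>x \<in> crossings H p \<gamma>. card {e \<in> edges H. x \<in> path_image (\<gamma> e)} = 2) \<and>
    finite (crossings H p \<gamma>)"

text \<open>
  For a finite loopless multigraph drawings exist, so this infimum is a minimum and is finite.
\<close>

definition crossing_number :: "('v, 'e) multigraph \<Rightarrow> enat" where
  "crossing_number H = Inf {enat (card (crossings H p \<gamma>)) | p \<gamma>. is_drawing H p \<gamma>}"

definition random_ordering :: "nat \<Rightarrow> nat list pmf" where
  "random_ordering L = pmf_of_set (permutations_of_set {..<L})"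

end

theory Submission
  imports Defs "HOL-Real_Asymp.Real_Asymp"
begin

text \<open>
  A set \<open>U\<close> cuts few edges of the path \<open>0, 1, \<dots>, L - 1\<close> only if its indicator word has few
  changes, and few edges of the random path only if the word of the positions of its elements has few
  changes. There are at most \<open>exp (\<epsilon> L)\<close> such words, while given \<open>U\<close> the position set is uniform
  among \<open>L choose card U \<ge> 2 powr (L / 3)\<close> sets; a union bound over pairs of words gives the
  probability estimate.

  For crossing numbers, turn the crossings of a drawing into vertices. The result is a plane graph with
  \<open>L + cr\<close> vertices; it has no \<open>K\<^sub>6\<close> minor, because \<open>K\<^sub>3\<^sub>,\<^sub>3\<close> cannot be
  drawn (Janiszewski's theorem), so by Alon, Seymour and Thomas it has a balanced separator of size
  \<open>O(sqrt (L + cr))\<close>. Every edge of the path pair leaving a union of components passes through the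
  separator, and at most four pass through each point. Hence \<open>cr < c L\<^sup>2\<close> yields a balanced set with
  fewer than \<open>\<eta> L\<close> boundary edges, which is exponentially unlikely.
\<close>

section \<open>Separators in graphs without a complete minor\<close>

text \<open>Edges are merely continuous arcs, so faces and Euler's formula are avoided. Planarity
  enters through Janiszewski's theorem, which needs sets with connected intersection; therefore
  branch sets are replaced by spanning trees, whose drawings do not separate the plane, glued to one
  another at single points. The obstruction reached in this way is K33, which has six branch sets;
  so K6 rather than K5 is excluded, at the cost of a constant. The separator is small compared with
  all L + cr points but has to balance only the L original vertices, so the separator theorem
  carries a weight set \<open>W\<close>. The square root is essential: cr < c L^2 gives a separator
  of order (sqrt c) L + sqrt L, which is below a fixed multiple of L once c is small and L is
  large.\<close>

definition closed_in :: "('a \<Rightarrow> 'a \<Rightarrow> bool) \<Rightarrow> 'a set \<Rightarrow> 'a set \<Rightarrow> bool" where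
  "closed_in E S T \<longleftrightarrow> T \<subseteq> S \<and> (\<forall>a\<in>T. \<forall>b\<in>S. E a b \<longrightarrow> b \<in> T)"

text \<open>For symmetric \<open>E\<close> the \<open>closed_in\<close> sets are the unions of
  components, so connectedness can be handled without paths. The empty set is connected, hence the
  nonemptiness conditions in \<open>component_in\<close> and \<open>covey\<close>.\<close>

definition conn :: "('a \<Rightarrow> 'a \<Rightarrow> bool) \<Rightarrow> 'a set \<Rightarrow> bool" where
  "conn E S \<longleftrightarrow> (\<forall>T. closed_in E S T \<longrightarrow> T = {} \<or> T = S)"

definition adj :: "('a \<Rightarrow> 'a \<Rightarrow> bool) \<Rightarrow> 'a set \<Rightarrow> 'a set \<Rightarrow> bool" where
  "adj E A B \<longleftrightarrow> (\<exists>a\<in>A. \<exists>b\<in>B. E a b)"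

definition reach :: "('a \<Rightarrow> 'a \<Rightarrow> bool) \<Rightarrow> 'a set \<Rightarrow> 'a set \<Rightarrow> 'a set" where
  "reach E S A = \<Inter>{T. closed_in E S T \<and> A \<subseteq> T}"

definition component_in :: "('a \<Rightarrow> 'a \<Rightarrow> bool) \<Rightarrow> 'a set \<Rightarrow> 'a set \<Rightarrow> bool" where
  "component_in E S B \<longleftrightarrow> B \<noteq> {} \<and> closed_in E S B \<and> conn E B"

text \<open>
  A covey with \<open>h\<close> members consists of the branch sets of a \<open>K\<^sub>h\<close> minor.
\<close>

definition covey :: "('a \<Rightarrow> 'a \<Rightarrow> bool) \<Rightarrow> 'a set \<Rightarrow> 'a set set \<Rightarrow> bool" where
  "covey E V \<C> \<longleftrightarrow> finite \<C> \<and> (\<forall>C\<in>\<C>. C \<noteq> {} \<and> C \<subseteq> V \<and> conn E C) \<and>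
     (\<forall>C\<in>\<C>. \<forall>D\<in>\<C>. C \<noteq> D \<longrightarrow> C \<inter> D = {} \<and> adj E C D)"

lemma connD: "conn E S \<Longrightarrow> closed_in E S T \<Longrightarrow> T \<noteq> {} \<Longrightarrow> T = S"
  by (auto simp: conn_def)

lemma conn_singleton: "conn E {v}"
  by (auto simp: conn_def closed_in_def)

lemma conn_subset_closed_in:
  assumes "conn E D" "closed_in E S T" "D \<subseteq> S" "D \<inter> T \<noteq> {}"
  shows "D \<subseteq> T"
proof -
  have "closed_in E D (D \<inter> T)" using assms(2,3) by (auto simp: closed_in_def)
  with connD[OF assms(1)] assms(4) show ?thesis by blast
qed

lemma conn_Un:
  assumes "conn E A" "conn E B" "A \<inter> B \<noteq> {}"
  shows "conn E (A \<union> B)"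
  unfolding conn_def
proof (intro allI impI)
  fix T assume T: "closed_in E (A \<union> B) T"
  show "T = {} \<or> T = A \<union> B"
  proof (cases "T = {}")
    case False
    have TA: "closed_in E A (T \<inter> A)" and TB: "closed_in E B (T \<inter> B)"
      using T by (auto simp: closed_in_def)
    have "T \<inter> A = A \<or> T \<inter> B = B" using TA TB False T assms(1,2)
      by (metis Int_Un_distrib Un_empty_left closed_in_def conn_def inf.absorb1 sup_bot_left)
    then have "T \<inter> A \<noteq> {}" "T \<inter> B \<noteq> {}" using assms(3) by blast+
    then have "T \<inter> A = A" "T \<inter> B = B" using connD[OF assms(1) TA] connD[OF assms(2) TB] by auto
    then show ?thesis using T by (auto simp: closed_in_def)
  qed simp
qed

lemma conn_insert:
  assumes "conn E A" "symp E" "u \<in> A" "E u v"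
  shows "conn E (insert v A)"
proof -
  have "conn E {u, v}"
    using assms(2,4) by (auto simp: conn_def closed_in_def symp_def)
  then have "conn E (A \<union> {u, v})" using assms by (intro conn_Un) auto
  moreover have "A \<union> {u, v} = insert v A" using assms by auto
  ultimately show ?thesis by simp
qed

lemma conn_UN:
  assumes "finite I" "I \<noteq> {}" "\<And>i. i \<in> I \<Longrightarrow> conn E (T i) \<and> v \<in> T i"
  shows "conn E (\<Union>i\<in>I. T i)"
  using assms
proof (induction I rule: finite_ne_induct)
  case (insert i I)
  then show ?case by (auto intro!: conn_Un)
qed auto

lemma reach_subset: "A \<subseteq> S \<Longrightarrow> reach E S A \<subseteq> S"
  and reach_superset: "A \<subseteq> reach E S A"
  and closed_in_reach: "A \<subseteq> S \<Longrightarrow> closed_in E S (reach E S A)"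
  and reach_least: "closed_in E S T \<Longrightarrow> A \<subseteq> T \<Longrightarrow> reach E S A \<subseteq> T"
proof -
  have S: "closed_in E S S" by (auto simp: closed_in_def)
  show "A \<subseteq> S \<Longrightarrow> reach E S A \<subseteq> S" using S by (auto simp: reach_def)
  then show "A \<subseteq> S \<Longrightarrow> closed_in E S (reach E S A)"
    unfolding closed_in_def reach_def by blast
qed (auto simp: reach_def)

lemma closed_in_Diff:
  assumes "symp E" "closed_in E S R" "closed_in E S T"
  shows "closed_in E S (R - T)"
  unfolding closed_in_def
proof (intro conjI ballI impI)
  fix a b assume ab: "a \<in> R - T" "b \<in> S" "E a b"
  have "b \<notin> T"
  proof
    assume "b \<in> T"
    moreover have "E b a" "a \<in> S" using ab assms by (auto simp: closed_in_def symp_def)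
    ultimately show False using assms(3) ab(1) unfolding closed_in_def by blast
  qed
  then show "b \<in> R - T" using ab assms(2) by (auto simp: closed_in_def)
qed (use assms(2) in \<open>auto simp: closed_in_def\<close>)

lemma component_of_vertex:
  assumes "symp E" "v \<in> S"
  obtains B where "component_in E S B" "v \<in> B"
proof
  let ?B = "reach E S {v}"
  show v: "v \<in> ?B" using reach_superset[of "{v}"] by auto
  have c: "closed_in E S ?B" using assms by (intro closed_in_reach) auto
  have "conn E ?B"
    unfolding conn_def
  proof (intro allI impI)
    fix T assume T: "closed_in E ?B T"
    then have T': "closed_in E S T" using c by (auto simp: closed_in_def)
    have "v \<in> T \<Longrightarrow> ?B \<subseteq> T" using reach_least[OF T', of "{v}"] by auto
    moreover have "v \<notin> T \<Longrightarrow> ?B \<subseteq> ?B - T"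
      using v by (intro reach_least[OF closed_in_Diff[OF assms(1) c T']]) auto
    ultimately show "T = {} \<or> T = ?B" using T by (auto simp: closed_in_def)
  qed
  then show "component_in E S ?B" using v c by (auto simp: component_in_def)
qed

text \<open>Lets a branch set absorb all that it reaches in \<open>S\<close>. A closed part that
  misses \<open>C\<close> misses \<open>A\<close>; its complement in \<open>reach E S A\<close> is
  then closed and contains \<open>A\<close>, hence is everything.\<close>

lemma conn_Un_reach:
  assumes "symp E" "conn E C" "C \<noteq> {}" "A \<subseteq> S" "C \<inter> S = {}" "\<And>a. a \<in> A \<Longrightarrow> \<exists>c\<in>C. E c a"
  shows "conn E (C \<union> reach E S A)"
  unfolding conn_def
proof (intro allI impI)
  let ?R = "reach E S A"
  fix T assume T: "closed_in E (C \<union> ?R) T"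
  have RS: "?R \<subseteq> S" and Rc: "closed_in E S ?R" and AR: "A \<subseteq> ?R"
    using reach_subset[OF assms(4)] closed_in_reach[OF assms(4)] reach_superset[of A] by blast+
  have TR: "closed_in E S (T \<inter> ?R)" using T Rc by (auto simp: closed_in_def)
  have TC: "closed_in E C (T \<inter> C)" using T by (auto simp: closed_in_def)
  show "T = {} \<or> T = C \<union> ?R"
  proof (cases "T \<inter> C = {}")
    case True
    have "A \<inter> T = {}"
    proof (rule ccontr)
      assume "A \<inter> T \<noteq> {}"
      then obtain a c where "a \<in> A" "a \<in> T" "c \<in> C" "E a c"
        using assms(1,6) by (auto simp: symp_def; blast)
      then show False using T True by (auto simp: closed_in_def)
    qed
    then have "A \<subseteq> ?R - (T \<inter> ?R)" using AR by auto
    from reach_least[OF closed_in_Diff[OF assms(1) Rc TR] this]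
    have "?R \<inter> T = {}" by blast
    then show ?thesis using True T by (auto simp: closed_in_def)
  next
    case False
    then have CT: "C \<subseteq> T" using connD[OF assms(2) TC] by auto
    have "A \<subseteq> T"
    proof
      fix a assume a: "a \<in> A"
      then obtain c where "c \<in> C" "E c a" using assms(6) by blast
      then show "a \<in> T" using T CT AR a unfolding closed_in_def by blast
    qed
    then have "?R \<subseteq> T" using reach_least[OF TR] AR by auto
    then show ?thesis using T CT by (auto simp: closed_in_def)
  qed
qed

section \<open>Distance layers\<close>

text \<open>Balls around \<open>A \<inter> B\<close> in the graph metric of \<open>B\<close>; the
  sets \<open>layer\<close> are the spheres.\<close>

fun nbhd :: "('a \<Rightarrow> 'a \<Rightarrow> bool) \<Rightarrow> 'a set \<Rightarrow> 'a set \<Rightarrow> nat \<Rightarrow> 'a set" where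
  "nbhd E B A 0 = A \<inter> B"
| "nbhd E B A (Suc j) = nbhd E B A j \<union> {v \<in> B. \<exists>u\<in>nbhd E B A j. E u v}"

fun layer :: "('a \<Rightarrow> 'a \<Rightarrow> bool) \<Rightarrow> 'a set \<Rightarrow> 'a set \<Rightarrow> nat \<Rightarrow> 'a set" where
  "layer E B A 0 = A \<inter> B"
| "layer E B A (Suc j) = nbhd E B A (Suc j) - nbhd E B A j"

lemma nbhd_subset: "nbhd E B A j \<subseteq> B"
  by (induction j) auto

lemma nbhd_mono: "i \<le> j \<Longrightarrow> nbhd E B A i \<subseteq> nbhd E B A j"
  by (rule lift_Suc_mono_le[of "nbhd E B A"]) auto

lemma layer_subset_nbhd: "layer E B A j \<subseteq> nbhd E B A j"
  by (cases j) auto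

lemma layer_disjoint: "i < j \<Longrightarrow> layer E B A i \<inter> layer E B A j = {}"
proof -
  assume "i < j"
  then obtain k where k: "j = Suc k" "i \<le> k" by (cases j) auto
  then show ?thesis using nbhd_mono[OF k(2), of E B A] layer_subset_nbhd[of E B A i] by auto
qed

text \<open>Pigeonhole: the first \<rho> spheres are disjoint subsets of \<open>B\<close>.\<close>

lemma small_layer:
  assumes "finite B" "\<rho> > 0"
  shows "\<exists>j<\<rho>. card (layer E B A j) * \<rho> \<le> card B"
proof (rule ccontr)
  assume "\<not> ?thesis"
  then have less: "\<And>j. j < \<rho> \<Longrightarrow> card B < card (layer E B A j) * \<rho>" by force
  have sub: "layer E B A j \<subseteq> B" for j using layer_subset_nbhd nbhd_subset by fast
  have "(\<Sum>j<\<rho>. card (layer E B A j)) = card (\<Union>j<\<rho>. layer E B A j)"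
  proof (rule card_UN_disjoint[symmetric])
    show "\<forall>i\<in>{..<\<rho>}. \<forall>j\<in>{..<\<rho>}. i \<noteq> j \<longrightarrow> layer E B A i \<inter> layer E B A j = {}"
      by (metis Int_commute layer_disjoint linorder_neqE_nat)
  qed (use assms(1) sub finite_subset in blast)+
  also have "\<dots> \<le> card B" using sub assms(1) by (intro card_mono) auto
  finally have "(\<Sum>j<\<rho>. card (layer E B A j) * \<rho>) \<le> card B * \<rho>"
    by (metis mult_le_mono1 sum_distrib_right)
  moreover have "(\<Sum>j<\<rho>. card B) < (\<Sum>j<\<rho>. card (layer E B A j) * \<rho>)"
    using less assms(2) by (intro sum_strict_mono) auto
  ultimately show False by (simp add: mult.commute)
qed

text \<open>Along an edge the distance to \<open>A\<close> changes by at most one, so a connected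
  set cannot get past the sphere of radius \<open>j\<close> without meeting it.\<close>

lemma conn_avoiding_layer:
  assumes "conn E D" "D \<subseteq> B" "D \<inter> layer E B A j = {}" "D \<inter> A \<noteq> {}"
  shows "D \<subseteq> nbhd E B A j"
proof (rule conn_subset_closed_in[OF assms(1) _ subset_refl, THEN subset_trans])
  show "closed_in E D (D \<inter> nbhd E B A j)"
    using assms(2,3) by (cases j) (auto simp: closed_in_def)
  show "D \<inter> (D \<inter> nbhd E B A j) \<noteq> {}"
    using nbhd_mono[of 0 j E B A] assms(2,4) by auto
qed auto

text \<open>\<open>T\<close> is the vertex set of a path of length at most \<open>j\<close> from
  \<open>v\<close> back to \<open>A\<close>.\<close>

lemma nbhd_witness:
  assumes "symp E" "v \<in> nbhd E B A j"
  shows "\<exists>T\<subseteq>B. conn E T \<and> v \<in> T \<and> T \<inter> A \<noteq> {} \<and> finite T \<and> card T \<le> Suc j"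
  using assms(2)
proof (induction j arbitrary: v)
  case 0
  then show ?case by (intro exI[of _ "{v}"]) (auto simp: conn_singleton)
next
  case (Suc j)
  show ?case
  proof (cases "v \<in> nbhd E B A j")
    case True
    with Suc.IH show ?thesis by (meson le_SucI)
  next
    case False
    then obtain u where u: "v \<in> B" "u \<in> nbhd E B A j" "E u v" using Suc.prems by auto
    then obtain T where T: "T \<subseteq> B" "conn E T" "u \<in> T" "T \<inter> A \<noteq> {}" "finite T" "card T \<le> Suc j"
      using Suc.IH[OF u(2)] by (elim exE conjE)
    have "conn E (insert v T)" by (rule conn_insert[OF T(2) assms(1) T(3) u(3)])
    moreover have "card (insert v T) \<le> Suc (Suc j)" using T by (simp add: card_insert_if)
    ultimately show ?thesis using u T by (intro exI[of _ "insert v T"]) simp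
  qed
qed

text \<open>
  If no vertex is within distance \<open>\<rho>\<close> of every \<open>A i\<close>, removing one small layer around each \<open>A i\<close>
  leaves no connected set meeting all of them.
\<close>

lemma connector_or_separator:
  assumes "symp E" "finite B" "finite I" "I \<noteq> {}" "\<rho> > 0"
  obtains (connector) T where "T \<subseteq> B" "conn E T" "card T \<le> card I * Suc \<rho>" "T \<noteq> {}"
      "\<And>i. i \<in> I \<Longrightarrow> T \<inter> A i \<noteq> {}"
  | (separator) Z where "Z \<subseteq> B" "card Z * \<rho> \<le> card I * card B"
      "\<And>D. D \<subseteq> B - Z \<Longrightarrow> conn E D \<Longrightarrow> \<exists>i\<in>I. D \<inter> A i = {}"
proof -
  have "\<forall>i\<in>I. \<exists>j<\<rho>. card (layer E B (A i) j) * \<rho> \<le> card B"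
    using small_layer assms(2,5) by blast
  then obtain j where j: "\<And>i. i \<in> I \<Longrightarrow> j i < \<rho> \<and> card (layer E B (A i) (j i)) * \<rho> \<le> card B"
    by metis
  show ?thesis
  proof (cases "\<exists>v. \<forall>i\<in>I. v \<in> nbhd E B (A i) \<rho>")
    case True
    then obtain v where "\<forall>i\<in>I. v \<in> nbhd E B (A i) \<rho>" by blast
    then have "\<forall>i\<in>I. \<exists>T\<subseteq>B. conn E T \<and> v \<in> T \<and> T \<inter> A i \<noteq> {} \<and> finite T \<and> card T \<le> Suc \<rho>"
      by (intro ballI nbhd_witness assms(1)) simp
    from bchoice[OF this] obtain T where "\<forall>i\<in>I. T i \<subseteq> B \<and> conn E (T i) \<and> v \<in> T i
        \<and> T i \<inter> A i \<noteq> {} \<and> finite (T i) \<and> card (T i) \<le> Suc \<rho>" by (rule exE)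
    then have T: "T i \<subseteq> B" "conn E (T i)" "v \<in> T i" "T i \<inter> A i \<noteq> {}" "card (T i) \<le> Suc \<rho>"
      if "i \<in> I" for i using that by simp_all
    show ?thesis
    proof (rule connector)
      show "conn E (\<Union>i\<in>I. T i)" using T assms by (intro conn_UN[of _ _ _ v]) auto
      have "card (\<Union>i\<in>I. T i) \<le> (\<Sum>i\<in>I. card (T i))" using assms(3) by (rule card_UN_le)
      also have "\<dots> \<le> card I * Suc \<rho>" using T sum_bounded_above[of I "\<lambda>i. card (T i)" "Suc \<rho>"] by auto
      finally show "card (\<Union>i\<in>I. T i) \<le> card I * Suc \<rho>" .
      show "(\<Union>i\<in>I. T i) \<subseteq> B" using T(1) by blast
      show "(\<Union>i\<in>I. T i) \<noteq> {}" using T(3) assms(4) by blast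
      show "(\<Union>i\<in>I. T i) \<inter> A i \<noteq> {}" if "i \<in> I" for i using T(4)[OF that] that by blast
    qed
  next
    case False
    let ?Z = "\<Union>i\<in>I. layer E B (A i) (j i)"
    show ?thesis
    proof (rule separator)
      show "?Z \<subseteq> B" using layer_subset_nbhd nbhd_subset by fast
      have "card ?Z * \<rho> \<le> (\<Sum>i\<in>I. card (layer E B (A i) (j i))) * \<rho>"
        using assms(3) by (intro mult_le_mono1 card_UN_le)
      also have "\<dots> = (\<Sum>i\<in>I. card (layer E B (A i) (j i)) * \<rho>)" by (rule sum_distrib_right)
      also have "\<dots> \<le> card I * card B" using j
          sum_bounded_above[of I "\<lambda>i. card (layer E B (A i) (j i)) * \<rho>" "card B"] by auto
      finally show "card ?Z * \<rho> \<le> card I * card B" .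
    next
      fix D assume D: "D \<subseteq> B - ?Z" "conn E D"
      show "\<exists>i\<in>I. D \<inter> A i = {}"
      proof (rule ccontr)
        assume no: "\<not> ?thesis"
        have "D \<subseteq> nbhd E B (A i) \<rho>" if "i \<in> I" for i
        proof -
          have "D \<subseteq> nbhd E B (A i) (j i)"
            using D that no by (intro conn_avoiding_layer) auto
          then show ?thesis using nbhd_mono[of "j i" \<rho> E B "A i"] j[OF that] by auto
        qed
        moreover have "D \<noteq> {}" using no assms(4) by auto
        ultimately show False using False by blast
      qed
    qed
  qed
qed

section \<open>Growing a covey beside a heavy component\<close>

abbreviation heavy :: "'a set \<Rightarrow> 'a set \<Rightarrow> bool" where
  "heavy W B \<equiv> card W < 2 * card (B \<inter> W)"

text \<open>Two strict majorities of \<open>W\<close> overlap; this is what nests the heavy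
  components belonging to different \<open>X\<close>.\<close>

lemma heavy_Int:
  assumes "finite W" "heavy W A" "heavy W B"
  shows "A \<inter> B \<noteq> {}"
proof
  assume "A \<inter> B = {}"
  then have "card ((A \<inter> W) \<union> (B \<inter> W)) = card (A \<inter> W) + card (B \<inter> W)"
    using assms(1) by (intro card_Un_disjoint) auto
  moreover have "card ((A \<inter> W) \<union> (B \<inter> W)) \<le> card W" using assms(1) by (intro card_mono) auto
  ultimately show False using assms(2,3) by linarith
qed

text \<open>The state of the descent. Charging at most \<open>r\<close> elements of \<open>X\<close>
  to each of fewer than \<open>h\<close> members keeps \<open>X\<close> below the size
  \<open>h * r\<close> up to which a heavy component of \<open>V - X\<close> is available.\<close>

definition covey_state ::
    "('a \<Rightarrow> 'a \<Rightarrow> bool) \<Rightarrow> 'a set \<Rightarrow> 'a set \<Rightarrow> nat \<Rightarrow> nat \<Rightarrow> 'a set set \<Rightarrow> 'a set \<Rightarrow> 'a set \<Rightarrow> bool" where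
  "covey_state E V W h r \<C> X B \<longleftrightarrow> covey E V \<C> \<and> card \<C> < h \<and> X \<subseteq> \<Union>\<C> \<and>
     (\<forall>C\<in>\<C>. card (X \<inter> C) \<le> r) \<and> component_in E (V - X) B \<and> heavy W B \<and> B \<inter> \<Union>\<C> = {}"

lemma covey_insert:
  assumes "symp E" "covey E V \<C>" "D \<noteq> {}" "D \<subseteq> V" "conn E D" "D \<inter> \<Union>\<C> = {}"
    "\<And>C. C \<in> \<C> \<Longrightarrow> adj E C D"
  shows "covey E V (insert D \<C>)"
proof -
  have "adj E D C" if "C \<in> \<C>" for C
    using assms(7)[OF that] assms(1) by (auto simp: adj_def symp_def)
  then show ?thesis using assms(2-7) unfolding covey_def by auto
qed

lemma covey_subset: "covey E V \<C> \<Longrightarrow> \<D> \<subseteq> \<C> \<Longrightarrow> covey E V \<D>"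
  unfolding covey_def by (meson finite_subset subsetD)

lemma card_subset_Union:
  assumes "finite \<C>" "X \<subseteq> \<Union>\<C>" "\<And>C. C \<in> \<C> \<Longrightarrow> card (X \<inter> C) \<le> r"
  shows "card X \<le> card \<C> * r"
proof -
  have "X = (\<Union>C\<in>\<C>. X \<inter> C)" using assms(2) by auto
  then have "card X \<le> (\<Sum>C\<in>\<C>. card (X \<inter> C))" by (metis assms(1) card_UN_le)
  also have "\<dots> \<le> card \<C> * r" using assms(3) by (rule sum_bounded_above[of \<C> _ r, simplified])
  finally show ?thesis .
qed

text \<open>
  Every small \<open>X\<close> leaves a heavy component \<open>B\<close>. Apply \<open>connector_or_separator\<close> inside \<open>B\<close>
  to the sets of neighbours of the members of the covey. A connector is a new member. A separator \<open>Z\<close>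
  cuts the heavy component of \<open>B - Z\<close> off from some member \<open>C1\<close>; enlarging \<open>C1\<close> by what it still
  reaches lets it absorb the relevant part of \<open>Z\<close>, so that \<open>X\<close> stays inside the covey with at most
  \<open>r\<close> elements in each member. Either way \<open>B\<close> shrinks.
\<close>

lemma covey_state_step:
  assumes E: "symp E" and fin: "finite V" "finite W"
    and \<rho>: "card V \<le> \<rho> * \<rho>" "\<rho> > 0" and r: "r = h * Suc \<rho>"
    and no_covey: "\<And>\<C>. covey E V \<C> \<Longrightarrow> card \<C> \<noteq> h"
    and heavy: "\<And>X. X \<subseteq> V \<Longrightarrow> card X \<le> h * r \<Longrightarrow> \<exists>B. component_in E (V - X) B \<and> heavy W B"
    and state: "covey_state E V W h r \<C> X B"
  shows "\<exists>\<C>' X' B'. covey_state E V W h r \<C>' X' B' \<and>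
      card B' * Suc h + card \<C>' < card B * Suc h + card \<C>"
proof -
  have cov: "covey E V \<C>" and card: "card \<C> < h" and XC: "X \<subseteq> \<Union>\<C>"
    and Xr: "\<And>C. C \<in> \<C> \<Longrightarrow> card (X \<inter> C) \<le> r" and comp: "component_in E (V - X) B"
    and hB: "heavy W B" and BC: "B \<inter> \<Union>\<C> = {}"
    using state by (auto simp: covey_state_def)
  have fC: "finite \<C>" and C: "\<And>C. C \<in> \<C> \<Longrightarrow> C \<noteq> {} \<and> C \<subseteq> V \<and> conn E C"
    and CD: "\<And>C D. C \<in> \<C> \<Longrightarrow> D \<in> \<C> \<Longrightarrow> C \<noteq> D \<Longrightarrow> C \<inter> D = {} \<and> adj E C D"
    using cov by (auto simp: covey_def)
  have Bne: "B \<noteq> {}" and Bcl: "closed_in E (V - X) B" and Bconn: "conn E B"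
    using comp by (auto simp: component_in_def)
  have BV: "B \<subseteq> V - X" using Bcl by (auto simp: closed_in_def)
  have finB: "finite B" using BV fin finite_subset by blast
  have XV: "X \<subseteq> V" using XC C by blast
  have cardX: "card X \<le> card \<C> * r" using card_subset_Union[OF fC XC] Xr by blast
  have Suc_r: "Suc (card \<C>) * r \<le> h * r" using card by (intro mult_le_mono1) auto
  \<comment> \<open>Covey sizes stay below \<open>Suc h\<close>, so the measure compares states
    lexicographically, first by \<open>card B\<close> and then by the size of the covey.\<close>
  have smaller: "card B' * Suc h + c < card B * Suc h + card \<C>" if "B' \<subset> B" "c < h" for B' c
  proof -
    have "Suc (card B') \<le> card B" using psubset_card_mono[OF finB that(1)] by simp
    then have "Suc (card B') * Suc h \<le> card B * Suc h" by (rule mult_le_mono1)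
    then show ?thesis using that(2) by simp
  qed
  have component_inside: "B' \<subseteq> F" if "component_in E (V - X') B'" "heavy W B'" "closed_in E (V - X') F"
    "B'' \<subseteq> F" "heavy W B''" for B' X' F B''
  proof (rule conn_subset_closed_in[OF _ that(3)])
    show "conn E B'" "B' \<subseteq> V - X'" using that(1) by (auto simp: component_in_def closed_in_def)
    show "B' \<inter> F \<noteq> {}" using heavy_Int[OF fin(2) that(2,5)] that(4) by blast
  qed
  show ?thesis
  proof (cases "\<forall>C\<in>\<C>. adj E C B")
    \<comment> \<open>A member with no edge to \<open>B\<close> is dropped together with its share
      of \<open>X\<close>. Here \<open>B\<close> remains a component and it is the covey that
      shrinks.\<close>
    case False
    then obtain C where CC: "C \<in> \<C>" "\<not> adj E C B" by blast
    have "covey_state E V W h r (\<C> - {C}) (X - C) B"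
      unfolding covey_state_def
    proof (intro conjI ballI)
      show "covey E V (\<C> - {C})" by (rule covey_subset[OF cov]) auto
      show "card (\<C> - {C}) < h" using card fC by (meson card_Diff1_le le_less_trans)
      show "X - C \<subseteq> \<Union> (\<C> - {C})" using XC by auto
      show "card ((X - C) \<inter> D) \<le> r" if "D \<in> \<C> - {C}" for D
      proof -
        have "(X - C) \<inter> D = X \<inter> D" using CD[of C D] CC that by auto
        then show ?thesis using Xr that by auto
      qed
      have "b \<in> B" if ab: "a \<in> B" "b \<in> V - (X - C)" "E a b" for a b
      proof -
        have "b \<notin> C"
        proof
          assume "b \<in> C"
          moreover have "E b a" using ab(3) E by (simp add: symp_def)
          ultimately show False using CC ab(1) unfolding adj_def by blast
        qed
        then show ?thesis using ab Bcl unfolding closed_in_def by blast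
      qed
      moreover have "B \<subseteq> V - (X - C)" using BV by blast
      ultimately show "component_in E (V - (X - C)) B"
        using Bne Bconn unfolding component_in_def closed_in_def by blast
      show "B \<inter> \<Union> (\<C> - {C}) = {}" using BC by blast
    qed (use hB in auto)
    moreover have "card (\<C> - {C}) < card \<C>" using CC fC by (meson card_Diff1_less)
    ultimately show ?thesis by (meson add_strict_left_mono)
  next
    case adjB: True
    have extend: ?thesis if T: "T \<subseteq> B" "conn E T" "card T \<le> r" "T \<noteq> {}" "\<And>C. C \<in> \<C> \<Longrightarrow> adj E C T" for T
    proof -
      have cov': "covey E V (insert T \<C>)"
        using T BV BC by (intro covey_insert[OF E cov]) auto
      have TC: "T \<notin> \<C>" using T BC by auto
      then have card': "card (insert T \<C>) = Suc (card \<C>)" using fC by simp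
      then have card'h: "card (insert T \<C>) < h" using no_covey[OF cov'] card by linarith
      have sub: "X \<union> T \<subseteq> \<Union> (insert T \<C>)" using XC by auto
      have small: "card ((X \<union> T) \<inter> D) \<le> r" if "D \<in> insert T \<C>" for D
      proof (cases "D = T")
        case True
        then show ?thesis using T by (simp add: Int_absorb2)
      next
        case False
        then have "(X \<union> T) \<inter> D = X \<inter> D" using that T BC by auto
        then show ?thesis using Xr that False by auto
      qed
      have "card (X \<union> T) \<le> card (insert T \<C>) * r"
        using card_subset_Union[OF _ sub small] fC by simp
      then have "card (X \<union> T) \<le> h * r" using card' Suc_r by simp
      moreover have "X \<union> T \<subseteq> V" using XV T BV by blast
      ultimately obtain B' where B': "component_in E (V - (X \<union> T)) B'" "heavy W B'"
        using heavy by blast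
      have B'V: "B' \<subseteq> V - (X \<union> T)" "conn E B'" using B'(1) by (auto simp: component_in_def closed_in_def)
      have "B' \<subseteq> B"
        using conn_subset_closed_in[OF B'V(2) Bcl] B'V(1) heavy_Int[OF fin(2) B'(2) hB] by blast
      then have "B' \<subset> B" using T B'V by blast
      moreover have "covey_state E V W h r (insert T \<C>) (X \<union> T) B'"
        using cov' card'h sub small B' \<open>B' \<subseteq> B\<close> BC B'V(1) unfolding covey_state_def by blast
      ultimately show ?thesis using smaller card'h by blast
    qed
    show ?thesis
    proof (cases "\<C> = {}")
      \<comment> \<open>The alternative requires at least one neighbour set, so an empty covey is
        started with a single vertex.\<close>
      case True
      obtain v where "v \<in> B" using Bne by blast
      then show ?thesis using r card True by (intro extend[of "{v}"]) (auto simp: conn_singleton)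
    next
      case False
      define A where "A C = {a\<in>B. \<exists>c\<in>C. E c a}" for C
      show ?thesis
      proof (rule connector_or_separator[OF E finB fC False \<rho>(2), of A])
        fix T assume T: "T \<subseteq> B" "conn E T" "card T \<le> card \<C> * Suc \<rho>" "T \<noteq> {}"
          "\<And>C. C \<in> \<C> \<Longrightarrow> T \<inter> A C \<noteq> {}"
        have "card \<C> * Suc \<rho> \<le> r" unfolding r using card by (intro mult_le_mono1) auto
        moreover have "adj E C T" if "C \<in> \<C>" for C
          using T(5)[OF that] by (auto simp: A_def adj_def)
        ultimately show ?thesis using T by (intro extend) auto
      next
        fix Z assume Z: "Z \<subseteq> B" "card Z * \<rho> \<le> card \<C> * card B"
          "\<And>D. D \<subseteq> B - Z \<Longrightarrow> conn E D \<Longrightarrow> \<exists>C\<in>\<C>. D \<inter> A C = {}"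
        \<comment> \<open>The choice of \<rho> as about sqrt (card V) balances the two outcomes:
          connector and separator both have at most \<open>h * Suc \<rho>\<close> elements.\<close>
        have "card B \<le> \<rho> * \<rho>" using card_mono[OF fin(1), of B] BV \<rho>(1) by force
        then have "card \<C> * card B \<le> h * (\<rho> * \<rho>)" using card by (intro mult_le_mono) auto
        with Z(2) have "card Z * \<rho> \<le> (h * \<rho>) * \<rho>" by (metis le_trans mult.assoc)
        then have "card Z \<le> h * \<rho>" using \<rho>(2) by simp
        then have Zr: "card Z \<le> r" by (simp add: r)
        have "card (X \<union> Z) \<le> card X + card Z" by (rule card_Un_le)
        also have "\<dots> \<le> h * r" using cardX Zr Suc_r by simp
        finally have "card (X \<union> Z) \<le> h * r" .
        moreover have "X \<union> Z \<subseteq> V" using XV Z(1) BV by blast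
        ultimately obtain B'' where B'': "component_in E (V - (X \<union> Z)) B''" "heavy W B''"
          using heavy by blast
        have B''cl: "closed_in E (V - (X \<union> Z)) B''" and B''conn: "conn E B''"
          using B''(1) by (auto simp: component_in_def)
        have B''V: "B'' \<subseteq> V - (X \<union> Z)" using B''cl by (auto simp: closed_in_def)
        have "B'' \<subseteq> B"
          using conn_subset_closed_in[OF B''conn Bcl] B''V heavy_Int[OF fin(2) B''(2) hB] by blast
        with B''V have B''B: "B'' \<subseteq> B - Z" by blast
        obtain C1 where C1: "C1 \<in> \<C>" "B'' \<inter> A C1 = {}" using Z(3)[OF B''B B''conn] by blast
        \<comment> \<open>What \<open>C1\<close> reaches in \<open>B\<close> without entering
          \<open>B''\<close>; a vertex of \<open>R\<close> with a neighbour in \<open>B''\<close>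
          must lie in \<open>Z\<close>.\<close>
        define R where "R = reach E (B - B'') (A C1)"
        have AB: "A C1 \<subseteq> B - B''" using C1(2) by (auto simp: A_def)
        have RB: "R \<subseteq> B - B''" and AR: "A C1 \<subseteq> R" and Rcl: "closed_in E (B - B'') R"
          unfolding R_def by (rule reach_subset[OF AB], rule reach_superset, rule closed_in_reach[OF AB])
        have Ane: "A C1 \<noteq> {}" using adjB C1(1) unfolding adj_def A_def by blast
        define D where "D = C1 \<union> R"
        \<comment> \<open>Absorbing \<open>R\<close> shields \<open>C1\<close> from the rest of
          \<open>B\<close>, so its old share of \<open>X\<close> is released, and
          \<open>Z \<inter> R\<close> becomes the share of the enlarged member.\<close>
        define X' where "X' = (X - C1) \<union> (Z \<inter> R)"
        define \<C>' where "\<C>' = insert D (\<C> - {C1})"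
        have Dconn: "conn E D" unfolding D_def R_def
          by (rule conn_Un_reach[OF E]) (use C C1 AB BC in \<open>auto simp: A_def\<close>)
        have cov': "covey E V \<C>'" unfolding \<C>'_def
        proof (rule covey_insert[OF E])
          show "covey E V (\<C> - {C1})" by (rule covey_subset[OF cov]) auto
          show "D \<noteq> {}" "D \<subseteq> V" using C C1 RB BV by (auto simp: D_def)
          show "conn E D" by (rule Dconn)
          show "D \<inter> \<Union> (\<C> - {C1}) = {}" using CD[of C1] C1(1) RB BC unfolding D_def by blast
          show "adj E C D" if "C \<in> \<C> - {C1}" for C
            using CD[of C C1] C1(1) that unfolding adj_def D_def by blast
        qed
        have card': "card \<C>' < h"
        proof -
          have "card \<C>' \<le> Suc (card (\<C> - {C1}))" unfolding \<C>'_def by (rule card_insert_le_m1) auto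
          also have "\<dots> = card \<C>" using C1(1) fC by (metis card_Suc_Diff1)
          finally show ?thesis using card by simp
        qed
        have sub': "X' \<subseteq> \<Union>\<C>'" using XC by (auto simp: X'_def \<C>'_def D_def)
        have small': "card (X' \<inter> G) \<le> r" if "G \<in> \<C>'" for G
        proof (cases "G = D")
          case True
          have "X' \<inter> D \<subseteq> Z" using RB BV by (auto simp: X'_def D_def)
          then have "card (X' \<inter> D) \<le> card Z"
            using finite_subset[OF Z(1) finB] by (intro card_mono)
          then show ?thesis using True Zr by simp
        next
          case False
          then have G: "G \<in> \<C>" "G \<noteq> C1" using that by (auto simp: \<C>'_def)
          have "X' \<inter> G = X \<inter> G" using CD[OF G(1) C1(1) G(2)] BC RB G(1) unfolding X'_def by blast
          then show ?thesis using Xr G by auto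
        qed
        have "card X' \<le> card \<C>' * r"
          using card_subset_Union[OF _ sub' small'] fC by (simp add: \<C>'_def)
        also have "\<dots> \<le> h * r" using card' by (intro mult_le_mono1) auto
        finally have "card X' \<le> h * r" .
        moreover have "X' \<subseteq> V" using XV Z(1) BV by (auto simp: X'_def)
        ultimately obtain B' where B': "component_in E (V - X') B'" "heavy W B'"
          using heavy by blast
        \<comment> \<open>A released vertex lies in \<open>C1\<close>, so its neighbours in
          \<open>B\<close> belong to \<open>A C1\<close>, which is part of \<open>R\<close>. An edge
          from \<open>B - R\<close> into \<open>R\<close> starts in \<open>B''\<close> and ends in
          \<open>Z \<inter> R\<close>, which \<open>X'\<close> contains.\<close>
        have closed: "closed_in E (V - X') (B - R)"
          unfolding closed_in_def
        proof (intro conjI ballI impI)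
          show "B - R \<subseteq> V - X'" using BV by (auto simp: X'_def)
          fix u b assume u: "u \<in> B - R" and b: "b \<in> V - X'" and ub: "E u b"
          have bu: "E b u" using ub E by (simp add: symp_def)
          show "b \<in> B - R"
          proof (cases "b \<in> X")
            case True
            then have "b \<in> C1" using b by (auto simp: X'_def)
            then have "u \<in> A C1" using u bu by (auto simp: A_def)
            then show ?thesis using AR u by blast
          next
            case False
            then have bB: "b \<in> B" using u b ub Bcl unfolding closed_in_def by blast
            have "b \<notin> R"
            proof
              assume bR: "b \<in> R"
              then have bZ: "b \<notin> Z" using b by (auto simp: X'_def)
              show False
              proof (cases "u \<in> B''")
                case True
                then have "b \<in> B''" using B''cl bB bZ BV ub unfolding closed_in_def by blast
                then show False using bR RB by blast
              next
                case False
                then show False using Rcl bR bu u unfolding closed_in_def by blast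
              qed
            qed
            then show ?thesis using bB by blast
          qed
        qed
        have "B'' \<subseteq> B - R" using B''B RB by blast
        then have B'R: "B' \<subseteq> B - R" by (rule component_inside[OF B' closed _ B''(2)])
        then have "B' \<subset> B" using Ane AR AB by blast
        moreover have "covey_state E V W h r \<C>' X' B'"
        proof -
          have "B' \<inter> \<Union>\<C>' = {}" using B'R BC C1(1) unfolding \<C>'_def D_def by blast
          then show ?thesis unfolding covey_state_def using cov' card' sub' small' B' by blast
        qed
        ultimately show ?thesis using smaller card' by blast
      qed
    qed
  qed
qed

text \<open>In a counterexample every \<open>X\<close> of the given size leaves a heavy component.
  The empty covey then provides a state, and \<open>covey_state_step\<close> descends from it
  forever. The factor h^2 is cruder than the known h^(3/2), but \<open>h\<close> will be 6.\<close>

theorem separator: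
  assumes E: "symp E" and fin: "finite V" "finite W"
    and \<rho>: "card V \<le> \<rho> * \<rho>" "\<rho> > 0" and h: "h > 0"
    and no_covey: "\<And>\<C>. covey E V \<C> \<Longrightarrow> card \<C> \<noteq> h"
  shows "\<exists>X\<subseteq>V. card X \<le> h * (h * Suc \<rho>) \<and>
    (\<forall>B. component_in E (V - X) B \<longrightarrow> 2 * card (B \<inter> W) \<le> card W)"
proof (rule ccontr)
  assume contra: "\<not> ?thesis"
  define r where "r = h * Suc \<rho>"
  have heavy: "\<exists>B. component_in E (V - X) B \<and> heavy W B" if "X \<subseteq> V" "card X \<le> h * r" for X
    using that contra unfolding r_def by (meson not_le)
  have no_state: "\<not> covey_state E V W h r \<C> X B" for \<C> X B
  proof (induction "card B * Suc h + card \<C>" arbitrary: \<C> X B rule: less_induct)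
    case less
    show ?case
      using covey_state_step[OF E fin \<rho> r_def no_covey heavy] less by blast
  qed
  obtain B where "component_in E (V - {}) B" "heavy W B" using heavy[of "{}"] by auto
  then have "covey_state E V W h r {} {} B"
    using h by (auto simp: covey_state_def covey_def)
  then show False using no_state by blast
qed

section \<open>Plane graphs have no large complete minor\<close>

text \<open>\<open>T\<close> does not separate \<open>a\<close> from \<open>y\<close>, so the
  frontier of \<open>W\<close> is not contained in \<open>T\<close> and has a point in
  \<open>N\<close>. The route from \<open>y\<close> through \<open>W\<close> to that point and on
  through \<open>N\<close> and \<open>M\<close> to \<open>a\<close> avoids \<open>X\<close>.\<close>

lemma connected_frontier_point:
  fixes S :: "complex set"
  assumes S: "closed S" and W: "W = connected_component_set (- S) y" and y: "y \<notin> S"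
    and a: "a \<notin> W" "a \<notin> T" and T: "connected (- T)" "T \<subseteq> S" and N: "S \<subseteq> T \<union> N"
    and NM: "connected N" "connected M" "M \<inter> N \<noteq> {}" "a \<in> M"
    and X: "X \<inter> W = {}" "X \<inter> N = {}" "X \<inter> M = {}"
  shows "connected_component (- X) a y"
proof -
  have yW: "y \<in> W" and cW: "connected W" using W y by auto
  have "W \<in> components (- S)" using W y by (auto simp: components_def)
  then have "frontier W \<subseteq> S" using S frontier_of_components_closed_complement by blast
  moreover have "- T \<inter> frontier W \<noteq> {}"
    by (rule connected_Int_frontier) (use T y yW a in auto)
  ultimately obtain q where q: "q \<in> frontier W" "q \<in> N" using N by blast
  have "connected (insert q W)"
    by (rule connected_intermediate_closure[OF cW]) (use q closure_subset in \<open>auto simp: frontier_def\<close>)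
  moreover have "connected (N \<union> M)" using NM by (intro connected_Un) auto
  ultimately have "connected (insert q W \<union> (N \<union> M))" using q by (intro connected_Un[of "insert q W"]) auto
  then show ?thesis
    unfolding connected_component_def using X q yW NM
    by (intro exI[of _ "insert q W \<union> (N \<union> M)"]) auto
qed

text \<open>
  The sets \<open>A1\<close>, \<open>A2\<close> and \<open>B1\<close>, \<open>B2\<close>, \<open>B3\<close> stand for five vertices of
  \<open>K\<^sub>3\<^sub>,\<^sub>3\<close> with their edges; \<open>M\<^sub>j\<close> is the sixth vertex, containing \<open>a\<close>,
  with its edge to \<open>B\<^sub>j\<close>. The cycle \<open>X1\<close> separates \<open>a\<close> from some \<open>y\<close>. The component of
  \<open>y\<close> touches both \<open>B2\<close> and \<open>B3\<close>, for otherwise a tree would separate the plane; hence neither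
  \<open>X2\<close> nor \<open>X3\<close> separates \<open>a\<close> from \<open>y\<close>. As \<open>X2 \<inter> X3\<close> is connected,
  \<open>X2 \<union> X3 \<supseteq> X1\<close> does not separate them either.
\<close>

lemma no_K33_contact:
  fixes A1 A2 B1 B2 B3 :: "complex set"
  assumes compact: "compact A1" "compact A2" "compact B1" "compact B2" "compact B3"
    and connected: "connected A1" "connected A2" "connected B1" "connected B2" "connected B3"
    and nonseparating: "connected (- (A1 \<union> A2 \<union> B2))" "connected (- (A1 \<union> A2 \<union> B3))"
    and disjoint: "A1 \<inter> A2 = {}" "B1 \<inter> B2 \<subseteq> A1 \<union> A2" "B1 \<inter> B3 \<subseteq> A1 \<union> A2" "B2 \<inter> B3 \<subseteq> A1 \<union> A2"
    and touching: "A1 \<inter> B1 \<noteq> {}" "A1 \<inter> B2 \<noteq> {}" "A1 \<inter> B3 \<noteq> {}"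
      "A2 \<inter> B1 \<noteq> {}" "A2 \<inter> B2 \<noteq> {}" "A2 \<inter> B3 \<noteq> {}"
    and inner: "connected (B1 - (A1 \<union> A2))" "connected (B2 - (A1 \<union> A2))" "connected (B3 - (A1 \<union> A2))"
    and third: "connected M1" "connected M2" "connected M3" "a \<in> M1" "a \<in> M2" "a \<in> M3"
      "M1 \<inter> (B1 - (A1 \<union> A2)) \<noteq> {}" "M2 \<inter> (B2 - (A1 \<union> A2)) \<noteq> {}" "M3 \<inter> (B3 - (A1 \<union> A2)) \<noteq> {}"
      "M1 \<inter> (A1 \<union> A2 \<union> B2 \<union> B3) = {}" "M2 \<inter> (A1 \<union> A2 \<union> B1 \<union> B3) = {}"
      "M3 \<inter> (A1 \<union> A2 \<union> B1 \<union> B2) = {}"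
  shows False
proof -
  define X1 where "X1 = A1 \<union> A2 \<union> B2 \<union> B3"
  define X2 where "X2 = A1 \<union> A2 \<union> B1 \<union> B3"
  define X3 where "X3 = A1 \<union> A2 \<union> B1 \<union> B2"
  have cpt: "compact X1" "compact X2" "compact X3"
    using compact by (auto simp: X1_def X2_def X3_def intro!: compact_Un)
  have aX: "a \<notin> X1" "a \<notin> X2" "a \<notin> X3" using third by (auto simp: X1_def X2_def X3_def)
  \<comment> \<open>\<open>X1\<close> is the union of two connected compact sets whose intersection
    splits into two disjoint nonempty closed sets. The dual of Janiszewski's theorem forbids this if
    the complement is connected.\<close>
  have "\<not> connected (- X1)"
  proof
    assume "connected (- X1)"
    moreover have "X1 = (A1 \<union> B2) \<union> (A2 \<union> B3)" by (auto simp: X1_def)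
    ultimately have "connected ((A1 \<union> B2) \<inter> (A2 \<union> B3))"
      using compact connected touching
      by (intro Janiszewski_dual) (auto intro!: compact_Un connected_Un)
    moreover have "(A1 \<union> B2) \<inter> (A2 \<union> B3) = (A1 \<inter> B3) \<union> (A2 \<inter> B2)" using disjoint by auto
    moreover have closed: "closed (A1 \<inter> B3)" "closed (A2 \<inter> B2)"
      using compact by (auto intro!: closed_Int compact_imp_closed)
    ultimately have "connected ((A1 \<inter> B3) \<union> (A2 \<inter> B2))" by simp
    moreover have "(A1 \<inter> B3) \<inter> (A2 \<inter> B2) = {}" using disjoint by blast
    ultimately show False using touching connected_closed_set[OF closed_Un[OF closed]] closed
      by blast
  qed
  then obtain y where y: "y \<notin> X1" "\<not> connected_component (- X1) a y"
    using aX unfolding connected_iff_connected_component by (metis ComplD ComplI connected_component_sym connected_component_trans)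
  define W where "W = connected_component_set (- X1) y"
  have aW: "a \<notin> W" using y by (auto simp: W_def dest: connected_component_sym)
  have WX: "W \<inter> X1 = {}" using connected_component_subset[of "- X1" y] by (auto simp: W_def)
  \<comment> \<open>Outside \<open>X1\<close>, the inner part of \<open>B1\<close> is joined to
    \<open>a\<close> through \<open>M1\<close>, so it is not in the component of \<open>y\<close>.
    Hence \<open>W\<close> avoids \<open>X2\<close> and \<open>X3\<close> as well.\<close>
  have "W \<inter> (M1 \<union> (B1 - (A1 \<union> A2))) = {}"
  proof (rule ccontr)
    assume "W \<inter> (M1 \<union> (B1 - (A1 \<union> A2))) \<noteq> {}"
    then obtain w where w: "w \<in> W" "w \<in> M1 \<union> (B1 - (A1 \<union> A2))" by blast
    have "connected (M1 \<union> (B1 - (A1 \<union> A2)))" using third inner by (intro connected_Un) auto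
    moreover have "M1 \<union> (B1 - (A1 \<union> A2)) \<subseteq> - X1" using third(10) disjoint(2,3)
      unfolding X1_def by blast
    ultimately have "connected_component (- X1) w a"
      using w third unfolding connected_component_def
      by (intro exI[of _ "M1 \<union> (B1 - (A1 \<union> A2))"]) auto
    moreover have "connected_component (- X1) y w" using w by (auto simp: W_def)
    ultimately show False using y by (meson connected_component_sym connected_component_trans)
  qed
  then have WB: "W \<inter> X2 = {}" "W \<inter> X3 = {}" using WX by (auto simp: X1_def X2_def X3_def)
  have "connected_component (- X2) a y"
  proof (rule connected_frontier_point[OF _ W_def y(1) aW])
    show "closed X1" using cpt by (simp add: compact_imp_closed)
    show "connected (- (A1 \<union> A2 \<union> B3))" "connected (B2 - (A1 \<union> A2))" "connected M2" "a \<in> M2"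
      "M2 \<inter> (B2 - (A1 \<union> A2)) \<noteq> {}"
      using nonseparating third inner by blast+
    show "X2 \<inter> M2 = {}" "X2 \<inter> W = {}" using third(11) WB unfolding X2_def by blast+
    show "X2 \<inter> (B2 - (A1 \<union> A2)) = {}" using disjoint(2,4) unfolding X2_def by blast
  qed (use aX in \<open>auto simp: X1_def\<close>)
  moreover have "connected_component (- X3) a y"
  proof (rule connected_frontier_point[OF _ W_def y(1) aW])
    show "closed X1" using cpt by (simp add: compact_imp_closed)
    show "connected (- (A1 \<union> A2 \<union> B2))" "connected (B3 - (A1 \<union> A2))" "connected M3" "a \<in> M3"
      "M3 \<inter> (B3 - (A1 \<union> A2)) \<noteq> {}"
      using nonseparating third inner by blast+
    show "X3 \<inter> M3 = {}" "X3 \<inter> W = {}" using third(12) WB unfolding X3_def by blast+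
    show "X3 \<inter> (B3 - (A1 \<union> A2)) = {}" using disjoint(3,4) unfolding X3_def by blast
  qed (use aX in \<open>auto simp: X1_def\<close>)
  moreover have "connected (X2 \<inter> X3)"
  proof -
    have "X2 \<inter> X3 = (A1 \<union> B1) \<union> (A2 \<union> B1)" using disjoint(4) unfolding X2_def X3_def by blast
    moreover have "connected (A1 \<union> B1)" "connected (A2 \<union> B1)"
      using connected_Un touching connected by blast+
    moreover have "(A1 \<union> B1) \<inter> (A2 \<union> B1) \<noteq> {}" using touching by blast
    ultimately show ?thesis by (simp add: connected_Un)
  qed
  ultimately have "connected_component (- (X2 \<union> X3)) a y"
    using cpt by (intro Janiszewski) (auto intro: compact_imp_closed)
  moreover have "- (X2 \<union> X3) \<subseteq> - X1" by (auto simp: X1_def X2_def X3_def)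
  ultimately show False using y connected_component_of_subset by blast
qed

text \<open>A single point is connected, so Janiszewski's theorem applies. All larger nonseparating
  sets are glued together with this lemma.\<close>

lemma nonseparating_Un:
  fixes S T :: "complex set"
  assumes "compact S" "compact T" "connected (- S)" "connected (- T)" "S \<inter> T = {x}"
  shows "connected (- (S \<union> T))"
  using assms by (intro Janiszewski_connected) (auto intro: compact_imp_closed)

lemma connected_arc_diff_endpoint:
  fixes g :: "real \<Rightarrow> 'a::real_normed_vector"
  assumes "arc g" "x = pathstart g \<or> x = pathfinish g"
  shows "connected (path_image g - {x})"
proof -
  have *: "connected (path_image h - {pathfinish h})" if "arc h" for h :: "real \<Rightarrow> 'a"
  proof -
    have "path_image h - {pathfinish h} = h ` {0..<1}"
      using that by (fastforce simp: path_image_def pathfinish_def arc_def inj_on_def less_le)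
    moreover have "connected (h ` {0..<1})"
      by (rule connected_continuous_image)
        (use that in \<open>auto simp: arc_def path_def intro: continuous_on_subset\<close>)
    ultimately show ?thesis by simp
  qed
  show ?thesis using *[of g] *[of "reversepath g"] assms by (auto simp: arc_reversepath)
qed

section \<open>Subgraphs of a plane graph and their drawings\<close>

text \<open>
  An edge is the set \<open>d\<close> of its two ends, drawn as the arc \<open>seg d\<close>.
\<close>

locale plane_graph =
  fixes P :: "complex set" and F :: "complex set set" and seg :: "complex set \<Rightarrow> complex set"
  assumes finite_P: "finite P"
    and seg_arc: "d \<in> F \<Longrightarrow> \<exists>u\<in>P. \<exists>v\<in>P. \<exists>g. d = {u, v} \<and> arc g \<and> pathstart g = u \<and> pathfinish g = v \<and>
      seg d = path_image g"
    and seg_Int_P: "d \<in> F \<Longrightarrow> seg d \<inter> P = d"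
    and seg_Int_seg: "d \<in> F \<Longrightarrow> d' \<in> F \<Longrightarrow> d \<noteq> d' \<Longrightarrow> seg d \<inter> seg d' \<subseteq> P"
begin

definition E :: "complex \<Rightarrow> complex \<Rightarrow> bool" where "E u v \<longleftrightarrow> {u, v} \<in> F"

definition subgraph :: "complex set \<Rightarrow> complex set set \<Rightarrow> bool" where
  "subgraph V D \<longleftrightarrow> V \<subseteq> P \<and> D \<subseteq> F \<and> \<Union>D \<subseteq> V"

definition draw :: "complex set \<Rightarrow> complex set set \<Rightarrow> complex set" where
  "draw V D = V \<union> \<Union>(seg ` D)"

lemma symp_E: "symp E" by (simp add: symp_def E_def insert_commute)

lemma edge_nonempty: "d \<in> F \<Longrightarrow> d \<noteq> {}"
  using seg_arc by blast

lemma finite_F: "finite F"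
proof (rule finite_subset)
  show "F \<subseteq> Pow P" using seg_Int_P by blast
qed (use finite_P in simp)

lemma draw_Int_P: "subgraph V D \<Longrightarrow> draw V D \<inter> P = V"
  using seg_Int_P unfolding subgraph_def draw_def by blast

text \<open>Off \<open>P\<close> a point lies on at most one arc, so intersections in the plane
  reduce to intersections of vertex sets and edge sets.\<close>

lemma draw_Int:
  assumes "subgraph V D" "subgraph V' D'"
  shows "draw V D \<inter> draw V' D' = draw (V \<inter> V') (D \<inter> D')"
proof
  show "draw V D \<inter> draw V' D' \<subseteq> draw (V \<inter> V') (D \<inter> D')"
  proof
    fix x assume x: "x \<in> draw V D \<inter> draw V' D'"
    show "x \<in> draw (V \<inter> V') (D \<inter> D')"
    proof (cases "x \<in> P")
      case True
      then have "x \<in> V \<inter> V'" using x draw_Int_P[OF assms(1)] draw_Int_P[OF assms(2)] by blast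
      then show ?thesis by (simp add: draw_def)
    next
      case False
      then obtain d d' where d: "d \<in> D" "x \<in> seg d" "d' \<in> D'" "x \<in> seg d'"
        using x assms by (auto simp: draw_def subgraph_def)
      then have "d = d'" using seg_Int_seg[of d d'] False assms unfolding subgraph_def by blast
      then show ?thesis using d by (auto simp: draw_def)
    qed
  qed
qed (auto simp: draw_def)

lemma draw_disjoint:
  assumes "subgraph V D" "subgraph V' D'" "V \<inter> V' = {}"
  shows "draw V D \<inter> draw V' D' = {}"
proof -
  have "D \<inter> D' = {}" using assms edge_nonempty unfolding subgraph_def by blast
  then show ?thesis using draw_Int[OF assms(1,2)] assms(3) by (simp add: draw_def)
qed

lemma seg_edge:
  assumes "{u, v} \<in> F"
  shows "u \<noteq> v" "u \<in> P" "v \<in> P" "u \<in> seg {u, v}" "v \<in> seg {u, v}" "compact (seg {u, v})"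
    "connected (seg {u, v})" "connected (- seg {u, v})" "connected (seg {u, v} - {u})"
proof -
  obtain a b g where g: "a \<in> P" "b \<in> P" "{u, v} = {a, b}" "arc g" "pathstart g = a" "pathfinish g = b"
    "seg {u, v} = path_image g" using seg_arc[OF assms] by metis
  have "a \<noteq> b" using arc_distinct_ends[OF g(4)] g by auto
  then show "u \<noteq> v" "u \<in> P" "v \<in> P" using g by (auto simp: doubleton_eq_iff)
  show "u \<in> seg {u, v}" "v \<in> seg {u, v}" using seg_Int_P[OF assms] by blast+
  show "compact (seg {u, v})" "connected (seg {u, v})" "connected (- seg {u, v})"
    using g by (auto simp: compact_arc_image connected_arc_image connected_arc_complement)
  show "connected (seg {u, v} - {u})" unfolding g(7)
    by (rule connected_arc_diff_endpoint[OF g(4)]) (use g in \<open>auto simp: doubleton_eq_iff\<close>)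
qed

lemma compact_draw:
  assumes "subgraph V D"
  shows "compact (draw V D)"
proof -
  have "finite V" "finite D" using assms finite_subset finite_P finite_F by (auto simp: subgraph_def)
  moreover have "compact (seg d)" if "d \<in> D" for d
    using that assms seg_arc[of d] compact_arc_image by (metis subgraph_def subsetD)
  ultimately show ?thesis unfolding draw_def by (simp add: compact_Un compact_UN finite_imp_compact)
qed

text \<open>The arc to the new leaf \<open>u\<close> meets the old drawing in \<open>v\<close> only;
  gluing at one point preserves connectedness of the drawing and of its complement.\<close>

lemma attach_edge:
  assumes "subgraph S D" "v \<in> S" "u \<notin> S" "{u, v} \<in> F"
  shows "subgraph (insert u S) (insert {u, v} D)"
    and "draw (insert u S) (insert {u, v} D) = draw S D \<union> seg {u, v}"
    and "draw S D \<inter> seg {u, v} = {v}"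
    and "connected (draw S D) \<Longrightarrow> connected (draw (insert u S) (insert {u, v} D))"
    and "connected (- draw S D) \<Longrightarrow> connected (- draw (insert u S) (insert {u, v} D))"
proof -
  note e = seg_edge[OF assms(4)]
  show "subgraph (insert u S) (insert {u, v} D)" using assms e by (auto simp: subgraph_def)
  show eq: "draw (insert u S) (insert {u, v} D) = draw S D \<union> seg {u, v}"
    using assms e by (auto simp: draw_def)
  have "subgraph {u, v} {{u, v}}" using assms(4) e by (auto simp: subgraph_def)
  from draw_Int[OF assms(1) this]
  have "draw S D \<inter> draw {u, v} {{u, v}} = draw {v} (D \<inter> {{u, v}})" using assms(2,3) by simp
  moreover have "{u, v} \<notin> D" using assms by (auto simp: subgraph_def)
  ultimately show Int: "draw S D \<inter> seg {u, v} = {v}" using e by (auto simp: draw_def)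
  show "connected (draw (insert u S) (insert {u, v} D))" if "connected (draw S D)"
    unfolding eq using that e Int by (intro connected_Un) auto
  show "connected (- draw (insert u S) (insert {u, v} D))" if "connected (- draw S D)"
    unfolding eq using that e Int compact_draw[OF assms(1)] by (intro nonseparating_Un)
qed

text \<open>A spanning tree grown leaf by leaf: a largest partial one is closed in \<open>S\<close>,
  hence spans it. Acyclicity is recorded in the form in which it is applied, as connectedness of the
  complement.\<close>

lemma tree:
  assumes "conn E S" "S \<noteq> {}" "S \<subseteq> P"
  obtains D where "subgraph S D" "connected (draw S D)" "connected (- draw S D)"
proof -
  define Q where "Q T \<longleftrightarrow> T \<noteq> {} \<and> T \<subseteq> S \<and>
    (\<exists>D. subgraph T D \<and> connected (draw T D) \<and> connected (- draw T D))" for T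
  have finS: "finite S" using assms finite_P finite_subset by blast
  obtain s where s: "s \<in> S" using assms by blast
  have "Q {s}" unfolding Q_def using s assms(3)
    by (auto intro!: exI[of _ "{}"] connected_punctured_universe simp: subgraph_def draw_def)
  moreover have "card T < Suc (card S)" if "Q T" for T
    using that finS by (simp add: Q_def card_mono less_Suc_eq_le)
  ultimately obtain T where T: "Q T" "\<And>T'. Q T' \<Longrightarrow> card T' \<le> card T"
    using ex_has_greatest_nat[of Q "{s}" card] by (metis less_imp_le)
  then obtain D where D: "T \<noteq> {}" "T \<subseteq> S" "subgraph T D" "connected (draw T D)" "connected (- draw T D)"
    by (auto simp: Q_def)
  have "closed_in E S T"
    unfolding closed_in_def
  proof (intro conjI ballI impI)
    fix v u assume *: "v \<in> T" "u \<in> S" "E v u"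
    show "u \<in> T"
    proof (rule ccontr)
      assume "u \<notin> T"
      then have "Q (insert u T)" unfolding Q_def
        using * D attach_edge[OF D(3), of v u] by (auto simp: E_def insert_commute)
      then have "card (insert u T) \<le> card T" by (rule T(2))
      then show False using \<open>u \<notin> T\<close> D(2) finS by (simp add: finite_subset card_insert_if)
    qed
  qed (rule D(2))
  then have "T = S" using connD[OF assms(1)] D(1) by blast
  then show ?thesis using D that by blast
qed

section \<open>From six branch sets to K33\<close>

text \<open>\<open>VB\<close>, \<open>DB\<close> is a spanning tree of \<open>B\<close> with one
  extra leaf in \<open>A1\<close> and one in \<open>A2\<close>, so that its contacts with these sets
  are single points, at ends of arcs, and can be removed without disconnecting it.
  \<open>VM\<close>, \<open>DM\<close> extends the drawing of \<open>A3\<close> by one edge into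
  \<open>B\<close>.\<close>

lemma spoke:
  assumes A: "subgraph A1 D1" "subgraph A2 D2" "subgraph A3 D3" and B: "conn E B" "B \<noteq> {}" "B \<subseteq> P"
    and disjoint: "A1 \<inter> A2 = {}" "A1 \<inter> B = {}" "A2 \<inter> B = {}" "A3 \<inter> B = {}"
    and adj: "adj E A1 B" "adj E A2 B" "adj E A3 B" and A3: "connected (draw A3 D3)"
  obtains VB DB u1 u2 VM DM where
    "subgraph VB DB" "B \<subseteq> VB" "VB \<subseteq> B \<union> A1 \<union> A2" "\<forall>d\<in>DB. d \<inter> B \<noteq> {}"
    "VB \<inter> A1 = {u1}" "VB \<inter> A2 = {u2}" "connected (draw VB DB)" "connected (- draw VB DB)"
    "connected (draw VB DB - (draw A1 D1 \<union> draw A2 D2))"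
    "subgraph VM DM" "A3 \<subseteq> VM" "VM \<subseteq> A3 \<union> B" "VM \<inter> B \<noteq> {}" "connected (draw VM DM)"
proof -
  obtain u1 v1 where 1: "u1 \<in> A1" "v1 \<in> B" "{u1, v1} \<in> F" using adj by (auto simp: adj_def E_def)
  obtain u2 v2 where 2: "u2 \<in> A2" "v2 \<in> B" "{u2, v2} \<in> F" using adj by (auto simp: adj_def E_def)
  obtain u3 v3 where 3: "u3 \<in> A3" "v3 \<in> B" "{v3, u3} \<in> F"
    using adj by (auto simp: adj_def E_def insert_commute)
  obtain G where G: "subgraph B G" "connected (draw B G)" "connected (- draw B G)" using tree[OF B] by blast
  have u: "u1 \<notin> B" "u2 \<notin> insert u1 B" "v3 \<notin> A3" using 1 2 3 disjoint by auto
  note a1 = attach_edge[OF G(1) 1(2) u(1) 1(3)]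
  note a2 = attach_edge[OF a1(1) _ u(2) 2(3)]
  note a3 = attach_edge[OF A(3) 3(1) u(3) 3(3)]
  define VB where "VB = insert u2 (insert u1 B)"
  define DB where "DB = insert {u2, v2} (insert {u1, v1} G)"
  have subB: "subgraph VB DB" using a2(1) 2 by (simp add: VB_def DB_def)
  note e1 = seg_edge[OF 1(3)] and e2 = seg_edge[OF 2(3)]
  have "draw VB DB = draw B G \<union> seg {u1, v1} \<union> seg {u2, v2}"
    using a1(2) a2(2) 2 by (simp add: VB_def DB_def)
  moreover have "draw B G \<inter> (draw A1 D1 \<union> draw A2 D2) = {}"
    using draw_disjoint[OF G(1) A(1)] draw_disjoint[OF G(1) A(2)] disjoint by (simp add: Int_Un_distrib Int_commute)
  moreover have "seg {u1, v1} \<inter> (draw A1 D1 \<union> draw A2 D2) = {u1}"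
  proof -
    have "v1 \<notin> A1" "subgraph {u1, v1} {{u1, v1}}" using 1 disjoint e1 by (auto simp: subgraph_def)
    moreover have "draw {u1, v1} {{u1, v1}} = seg {u1, v1}" using e1 by (auto simp: draw_def)
    ultimately have "seg {u1, v1} \<inter> draw A2 D2 = {}"
      using draw_disjoint[OF _ A(2), of "{u1, v1}" "{{u1, v1}}"] 1 disjoint by auto
    moreover have "draw A1 D1 \<inter> seg {v1, u1} = {u1}"
      using attach_edge(3)[OF A(1) 1(1) \<open>v1 \<notin> A1\<close>] 1(3) by (simp add: insert_commute)
    ultimately show ?thesis by (simp add: Int_Un_distrib Int_commute insert_commute)
  qed
  moreover have "seg {u2, v2} \<inter> (draw A1 D1 \<union> draw A2 D2) = {u2}"
  proof -
    have "v2 \<notin> A2" "subgraph {u2, v2} {{u2, v2}}" using 2 disjoint e2 by (auto simp: subgraph_def)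
    moreover have "draw {u2, v2} {{u2, v2}} = seg {u2, v2}" using e2 by (auto simp: draw_def)
    ultimately have "seg {u2, v2} \<inter> draw A1 D1 = {}"
      using draw_disjoint[OF _ A(1), of "{u2, v2}" "{{u2, v2}}"] 2 disjoint by auto
    moreover have "draw A2 D2 \<inter> seg {v2, u2} = {u2}"
      using attach_edge(3)[OF A(2) 2(1) \<open>v2 \<notin> A2\<close>] 2(3) by (simp add: insert_commute)
    ultimately show ?thesis by (simp add: Int_Un_distrib Int_commute insert_commute)
  qed
  ultimately have "draw VB DB - (draw A1 D1 \<union> draw A2 D2) =
      draw B G \<union> (seg {u1, v1} - {u1}) \<union> (seg {u2, v2} - {u2})" by blast
  moreover have "connected (draw B G \<union> (seg {u1, v1} - {u1}) \<union> (seg {u2, v2} - {u2}))"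
  proof (intro connected_Un)
    have "v1 \<in> draw B G \<inter> (seg {u1, v1} - {u1})" "v2 \<in> draw B G \<inter> (seg {u2, v2} - {u2})"
      using 1 2 e1 e2 by (auto simp: draw_def)
    then show "draw B G \<inter> (seg {u1, v1} - {u1}) \<noteq> {}"
      "(draw B G \<union> (seg {u1, v1} - {u1})) \<inter> (seg {u2, v2} - {u2}) \<noteq> {}" by blast+
  qed (use G e1 e2 in auto)
  ultimately have inner: "connected (draw VB DB - (draw A1 D1 \<union> draw A2 D2))" by simp
  show thesis
  proof (rule that[OF subB _ _ _ _ _ _ _ inner a3(1)])
    show "B \<subseteq> VB" "VB \<subseteq> B \<union> A1 \<union> A2" using 1 2 by (auto simp: VB_def)
    show "\<forall>d\<in>DB. d \<inter> B \<noteq> {}"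
    proof
      fix d assume "d \<in> DB"
      then consider "d = {u2, v2}" | "d = {u1, v1}" | "d \<in> G" by (auto simp: DB_def)
      then show "d \<inter> B \<noteq> {}"
      proof cases
        case 3
        then show ?thesis using G(1) edge_nonempty[of d] unfolding subgraph_def by blast
      qed (use 1 2 in auto)
    qed
    show "VB \<inter> A1 = {u1}" "VB \<inter> A2 = {u2}" using 1 2 disjoint by (auto simp: VB_def)
    show "connected (draw VB DB)" "connected (- draw VB DB)"
      using a1(4,5) a2(4,5) G 2 by (auto simp: VB_def DB_def)
    show "A3 \<subseteq> insert v3 A3" "insert v3 A3 \<subseteq> A3 \<union> B" "insert v3 A3 \<inter> B \<noteq> {}" using 3 by auto
    show "connected (draw (insert v3 A3) (insert {v3, u3} D3))" using a3(4) A3 by blast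
  qed
qed

text \<open>Every edge of the spoke has an end in \<open>B\<close>, and no edge inside
  \<open>A\<close> has one. So the two drawings share no edge, only the leaf
  \<open>u\<close>.\<close>

lemma contact_point:
  assumes "subgraph A DA" "subgraph VB DB" "VB \<inter> A = {u}" "\<forall>d\<in>DB. d \<inter> B \<noteq> {}" "A \<inter> B = {}"
  shows "draw A DA \<inter> draw VB DB = {u}"
proof -
  have "False" if d: "d \<in> DA" "d \<in> DB" for d
  proof -
    obtain x where x: "x \<in> d" "x \<in> B" using assms(4) d(2) by blast
    then have "x \<in> A" using d(1) assms(1) by (auto simp: subgraph_def)
    then show False using x(2) assms(5) by blast
  qed
  then have "DA \<inter> DB = {}" by blast
  then show ?thesis using draw_Int[OF assms(1,2)] assms(3) by (simp add: draw_def Int_commute)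
qed

text \<open>Again no edge is shared, and the common vertices of two spokes are leaves in
  \<open>A1\<close> or \<open>A2\<close>.\<close>

lemma draw_Int_spokes:
  assumes "subgraph V D" "subgraph V' D'" "V \<subseteq> B \<union> A1 \<union> A2" "V' \<subseteq> B' \<union> A1 \<union> A2"
    "\<forall>d\<in>D. d \<inter> B \<noteq> {}" "B \<inter> B' = {}" "A1 \<inter> B = {}" "A2 \<inter> B = {}"
  shows "draw V D \<inter> draw V' D' \<subseteq> draw A1 D1 \<union> draw A2 D2"
proof -
  have "False" if d: "d \<in> D" "d \<in> D'" for d
  proof -
    obtain x where x: "x \<in> d" "x \<in> B" using assms(5) d(1) by blast
    then have "x \<in> V'" using d(2) assms(2) by (auto simp: subgraph_def)
    then show False using x(2) assms(4,6,7,8) by blast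
  qed
  then have "D \<inter> D' = {}" by blast
  then have "draw V D \<inter> draw V' D' = V \<inter> V'" using draw_Int[OF assms(1,2)] by (simp add: draw_def)
  also have "\<dots> \<subseteq> A1 \<union> A2" using assms by blast
  finally show ?thesis by (auto simp: draw_def)
qed

theorem no_covey_6:
  assumes cov: "covey E P \<C>"
  shows "card \<C> \<noteq> 6"
proof
  assume "card \<C> = 6"
  then obtain xs where xs: "set xs = \<C>" "distinct xs" "length xs = 6"
    using cov finite_distinct_list distinct_card unfolding covey_def by metis
  then obtain A1 A2 A3 B1 B2 B3 where xs_eq: "xs = [A1, A2, A3, B1, B2, B3]"
    by (auto simp: length_Suc_conv eval_nat_numeral)
  have mem: "A1 \<in> \<C>" "A2 \<in> \<C>" "A3 \<in> \<C>" "B1 \<in> \<C>" "B2 \<in> \<C>" "B3 \<in> \<C>" using xs xs_eq by auto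
  have dist: "distinct [A1, A2, A3, B1, B2, B3]" using xs xs_eq by simp
  have C: "C \<noteq> {}" "C \<subseteq> P" "conn E C" if "C \<in> \<C>" for C using that cov by (auto simp: covey_def)
  have CC: "C \<inter> D = {}" "adj E C D" if "C \<in> \<C>" "D \<in> \<C>" "C \<noteq> D" for C D
    using that cov by (auto simp: covey_def)
  note t = tree[OF C(3,1,2)]
  obtain D1 where D1: "subgraph A1 D1" "connected (draw A1 D1)" "connected (- draw A1 D1)" using t mem(1) by blast
  obtain D2 where D2: "subgraph A2 D2" "connected (draw A2 D2)" "connected (- draw A2 D2)" using t mem(2) by blast
  obtain D3 where D3: "subgraph A3 D3" "connected (draw A3 D3)" using t mem(3) by blast
  have dA: "A1 \<inter> A2 = {}" "A1 \<inter> A3 = {}" "A2 \<inter> A3 = {}" using CC mem dist by auto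
  have dB: "B1 \<inter> B2 = {}" "B1 \<inter> B3 = {}" "B2 \<inter> B3 = {}" using CC mem dist by auto
  have dAB1: "A1 \<inter> B1 = {}" "A2 \<inter> B1 = {}" "A3 \<inter> B1 = {}" using CC mem dist by auto
  have dAB2: "A1 \<inter> B2 = {}" "A2 \<inter> B2 = {}" "A3 \<inter> B2 = {}" using CC mem dist by auto
  have dAB3: "A1 \<inter> B3 = {}" "A2 \<inter> B3 = {}" "A3 \<inter> B3 = {}" using CC mem dist by auto
  have adj1: "adj E A1 B1" "adj E A2 B1" "adj E A3 B1" using CC mem dist by auto
  have adj2: "adj E A1 B2" "adj E A2 B2" "adj E A3 B2" using CC mem dist by auto
  have adj3: "adj E A1 B3" "adj E A2 B3" "adj E A3 B3" using CC mem dist by auto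
  let ?A1 = "draw A1 D1" and ?A2 = "draw A2 D2"
  obtain V1 G1 p1 q1 M1 H1 where s1: "subgraph V1 G1" "B1 \<subseteq> V1" "V1 \<subseteq> B1 \<union> A1 \<union> A2" "\<forall>d\<in>G1. d \<inter> B1 \<noteq> {}"
    "V1 \<inter> A1 = {p1}" "V1 \<inter> A2 = {q1}" "connected (draw V1 G1)" "connected (- draw V1 G1)"
    "connected (draw V1 G1 - (?A1 \<union> ?A2))"
    "subgraph M1 H1" "A3 \<subseteq> M1" "M1 \<subseteq> A3 \<union> B1" "M1 \<inter> B1 \<noteq> {}" "connected (draw M1 H1)"
    by (rule spoke[OF D1(1) D2(1) D3(1) C(3,1,2)[OF mem(4)] dA(1) dAB1 adj1 D3(2)])
  obtain V2 G2 p2 q2 M2 H2 where s2: "subgraph V2 G2" "B2 \<subseteq> V2" "V2 \<subseteq> B2 \<union> A1 \<union> A2" "\<forall>d\<in>G2. d \<inter> B2 \<noteq> {}"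
    "V2 \<inter> A1 = {p2}" "V2 \<inter> A2 = {q2}" "connected (draw V2 G2)" "connected (- draw V2 G2)"
    "connected (draw V2 G2 - (?A1 \<union> ?A2))"
    "subgraph M2 H2" "A3 \<subseteq> M2" "M2 \<subseteq> A3 \<union> B2" "M2 \<inter> B2 \<noteq> {}" "connected (draw M2 H2)"
    by (rule spoke[OF D1(1) D2(1) D3(1) C(3,1,2)[OF mem(5)] dA(1) dAB2 adj2 D3(2)])
  obtain V3 G3 p3 q3 M3 H3 where s3: "subgraph V3 G3" "B3 \<subseteq> V3" "V3 \<subseteq> B3 \<union> A1 \<union> A2" "\<forall>d\<in>G3. d \<inter> B3 \<noteq> {}"
    "V3 \<inter> A1 = {p3}" "V3 \<inter> A2 = {q3}" "connected (draw V3 G3)" "connected (- draw V3 G3)"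
    "connected (draw V3 G3 - (?A1 \<union> ?A2))"
    "subgraph M3 H3" "A3 \<subseteq> M3" "M3 \<subseteq> A3 \<union> B3" "M3 \<inter> B3 \<noteq> {}" "connected (draw M3 H3)"
    by (rule spoke[OF D1(1) D2(1) D3(1) C(3,1,2)[OF mem(6)] dA(1) dAB3 adj3 D3(2)])
  have k1: "?A1 \<inter> draw V1 G1 = {p1}" "?A2 \<inter> draw V1 G1 = {q1}"
    by (rule contact_point[OF D1(1) s1(1,5,4) dAB1(1)] contact_point[OF D2(1) s1(1,6,4) dAB1(2)]; assumption)+
  have k2: "?A1 \<inter> draw V2 G2 = {p2}" "?A2 \<inter> draw V2 G2 = {q2}"
    by (rule contact_point[OF D1(1) s2(1,5,4) dAB2(1)] contact_point[OF D2(1) s2(1,6,4) dAB2(2)]; assumption)+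
  have k3: "?A1 \<inter> draw V3 G3 = {p3}" "?A2 \<inter> draw V3 G3 = {q3}"
    by (rule contact_point[OF D1(1) s3(1,5,4) dAB3(1)] contact_point[OF D2(1) s3(1,6,4) dAB3(2)]; assumption)+
  have A12: "?A1 \<inter> ?A2 = {}" by (rule draw_disjoint[OF D1(1) D2(1) dA(1)])
  \<comment> \<open>The drawing of \<open>A1\<close> is glued to the spoke at one point, then that
    of \<open>A2\<close> at another.\<close>
  have nonsep: "connected (- (?A1 \<union> ?A2 \<union> draw V G))"
    if "subgraph V G" "connected (- draw V G)" "?A1 \<inter> draw V G = {p}" "?A2 \<inter> draw V G = {q}" for V G p q
  proof -
    have "connected (- (?A1 \<union> draw V G))"
      by (rule nonseparating_Un[OF compact_draw[OF D1(1)] compact_draw[OF that(1)] D1(3) that(2,3)])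
    moreover have "compact (?A1 \<union> draw V G)" using compact_draw D1(1) that(1) by (intro compact_Un)
    moreover have "?A2 \<inter> (?A1 \<union> draw V G) = {q}" using that(4) A12 by blast
    ultimately have "connected (- (?A2 \<union> (?A1 \<union> draw V G)))"
      using nonseparating_Un[OF compact_draw[OF D2(1)] _ D2(3)] by blast
    then show ?thesis by (simp add: Un_ac)
  qed
  obtain a where a: "a \<in> A3" using C(1)[OF mem(3)] by blast
  have hit: "draw M H \<inter> (draw V G - (?A1 \<union> ?A2)) \<noteq> {}"
    if "M \<inter> B \<noteq> {}" "B \<subseteq> V" "B \<subseteq> P" "A1 \<inter> B = {}" "A2 \<inter> B = {}" for M H V G B
  proof -
    from that(1) obtain x where x: "x \<in> M" "x \<in> B" by blast
    then have "x \<notin> ?A1 \<union> ?A2" using draw_Int_P[OF D1(1)] draw_Int_P[OF D2(1)] that by blast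
    then show ?thesis using x that by (auto simp: draw_def)
  qed
  have miss: "draw M H \<inter> (?A1 \<union> ?A2 \<union> draw V G \<union> draw V' G') = {}"
    if "subgraph M H" "M \<subseteq> A3 \<union> B" "subgraph V G" "V \<subseteq> C \<union> A1 \<union> A2" "subgraph V' G'" "V' \<subseteq> C' \<union> A1 \<union> A2"
      "A1 \<inter> B = {}" "A2 \<inter> B = {}" "B \<inter> C = {}" "B \<inter> C' = {}" "A3 \<inter> C = {}" "A3 \<inter> C' = {}"
    for M H B V G V' G' C C'
  proof -
    have M: "M \<inter> A1 = {}" "M \<inter> A2 = {}" using that(2,7,8) dA(2,3) by blast+
    moreover have "M \<inter> V = {}" using that(2,4,9,11) M by blast
    moreover have "M \<inter> V' = {}" using that(2,6,10,12) M by blast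
    ultimately show ?thesis using draw_disjoint[OF that(1)] D1(1) D2(1) that(3,5) by (simp add: Int_Un_distrib)
  qed
  show False
  proof (rule no_K33_contact[of ?A1 ?A2 "draw V1 G1" "draw V2 G2" "draw V3 G3" "draw M1 H1" "draw M2 H2" "draw M3 H3" a])
    show "compact ?A1" "compact ?A2" "compact (draw V1 G1)" "compact (draw V2 G2)" "compact (draw V3 G3)"
      by (rule compact_draw[OF D1(1)] compact_draw[OF D2(1)] compact_draw[OF s1(1)] compact_draw[OF s2(1)]
          compact_draw[OF s3(1)])+
    show "connected ?A1" "connected ?A2" "connected (draw V1 G1)" "connected (draw V2 G2)" "connected (draw V3 G3)"
      by (rule D1(2) D2(2) s1(7) s2(7) s3(7))+
    show "connected (- (?A1 \<union> ?A2 \<union> draw V2 G2))" by (rule nonsep[OF s2(1,8) k2])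
    show "connected (- (?A1 \<union> ?A2 \<union> draw V3 G3))" by (rule nonsep[OF s3(1,8) k3])
    show "?A1 \<inter> ?A2 = {}" by (rule A12)
    show "draw V1 G1 \<inter> draw V2 G2 \<subseteq> ?A1 \<union> ?A2"
      by (rule draw_Int_spokes[OF s1(1) s2(1) s1(3) s2(3) s1(4) dB(1) dAB1(1,2)])
    show "draw V1 G1 \<inter> draw V3 G3 \<subseteq> ?A1 \<union> ?A2"
      by (rule draw_Int_spokes[OF s1(1) s3(1) s1(3) s3(3) s1(4) dB(2) dAB1(1,2)])
    show "draw V2 G2 \<inter> draw V3 G3 \<subseteq> ?A1 \<union> ?A2"
      by (rule draw_Int_spokes[OF s2(1) s3(1) s2(3) s3(3) s2(4) dB(3) dAB2(1,2)])
    show "?A1 \<inter> draw V1 G1 \<noteq> {}" "?A1 \<inter> draw V2 G2 \<noteq> {}" "?A1 \<inter> draw V3 G3 \<noteq> {}"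
      "?A2 \<inter> draw V1 G1 \<noteq> {}" "?A2 \<inter> draw V2 G2 \<noteq> {}" "?A2 \<inter> draw V3 G3 \<noteq> {}"
      unfolding k1 k2 k3 by simp_all
    show "connected (draw V1 G1 - (?A1 \<union> ?A2))" "connected (draw V2 G2 - (?A1 \<union> ?A2))"
      "connected (draw V3 G3 - (?A1 \<union> ?A2))" by (rule s1(9) s2(9) s3(9))+
    show "connected (draw M1 H1)" "connected (draw M2 H2)" "connected (draw M3 H3)"
      by (rule s1(14) s2(14) s3(14))+
    show "a \<in> draw M1 H1" "a \<in> draw M2 H2" "a \<in> draw M3 H3"
      using a s1(11) s2(11) s3(11) by (auto simp: draw_def)
    show "draw M1 H1 \<inter> (draw V1 G1 - (?A1 \<union> ?A2)) \<noteq> {}"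
      by (rule hit[OF s1(13,2) C(2)[OF mem(4)] dAB1(1,2)])
    show "draw M2 H2 \<inter> (draw V2 G2 - (?A1 \<union> ?A2)) \<noteq> {}"
      by (rule hit[OF s2(13,2) C(2)[OF mem(5)] dAB2(1,2)])
    show "draw M3 H3 \<inter> (draw V3 G3 - (?A1 \<union> ?A2)) \<noteq> {}"
      by (rule hit[OF s3(13,2) C(2)[OF mem(6)] dAB3(1,2)])
    show "draw M1 H1 \<inter> (?A1 \<union> ?A2 \<union> draw V2 G2 \<union> draw V3 G3) = {}"
      by (rule miss[OF s1(10,12) s2(1,3) s3(1,3) dAB1(1,2) dB(1,2) dAB2(3) dAB3(3)])
    show "draw M2 H2 \<inter> (?A1 \<union> ?A2 \<union> draw V1 G1 \<union> draw V3 G3) = {}"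
      by (rule miss[OF s2(10,12) s1(1,3) s3(1,3) dAB2(1,2) _ dB(3) dAB1(3) dAB3(3)]) (use dB in blast)
    show "draw M3 H3 \<inter> (?A1 \<union> ?A2 \<union> draw V1 G1 \<union> draw V2 G2) = {}"
      by (rule miss[OF s3(10,12) s1(1,3) s2(1,3) dAB3(1,2) _ _ dAB1(3) dAB2(3)]) (use dB in blast)+
  qed
qed

end

section \<open>Balanced cuts from drawings\<close>

text \<open>\<open>D\<close> has the largest share of \<open>W\<close> not exceeding two thirds. If
  the share is below one third, a component with less than a third, or one vertex of
  \<open>X\<close>, could still be added; a component with at least a third is itself balanced.
  Closedness is asked of \<open>D - X\<close> only, so vertices of \<open>W\<close> inside
  \<open>X\<close> can go to either side.\<close>

lemma balanced_union_of_components: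
  assumes E: "symp E" and fin: "finite V" and WV: "W \<subseteq> V" and XV: "X \<subseteq> V" and W3: "card W \<ge> 3"
    and small: "\<And>B. component_in E (V - X) B \<Longrightarrow> 2 * card (B \<inter> W) \<le> card W"
  shows "\<exists>D\<subseteq>V. closed_in E (V - X) (D - X) \<and> card W \<le> 3 * card (D \<inter> W) \<and> 3 * card (D \<inter> W) \<le> 2 * card W"
proof -
  define Q where "Q D \<longleftrightarrow> D \<subseteq> V \<and> closed_in E (V - X) (D - X) \<and> 3 * card (D \<inter> W) \<le> 2 * card W" for D
  have finW: "finite W" using WV fin finite_subset by blast
  have "Q {}" by (simp add: Q_def closed_in_def)
  moreover have "card (D \<inter> W) < Suc (card W)" for D
    using finW by (simp add: card_mono less_Suc_eq_le)
  ultimately obtain D where D: "Q D" "\<And>D'. Q D' \<Longrightarrow> card (D' \<inter> W) \<le> card (D \<inter> W)"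
    using ex_has_greatest_nat[of Q "{}" "\<lambda>D. card (D \<inter> W)"] by (metis less_imp_le)
  have DV: "D \<subseteq> V" and Dcl: "closed_in E (V - X) (D - X)" using D(1) by (auto simp: Q_def)
  show ?thesis
  proof (cases "card W \<le> 3 * card (D \<inter> W)")
    case True
    then show ?thesis using D(1) by (auto simp: Q_def)
  next
    case False
    have "\<not> W \<subseteq> D" using False by (auto simp: Int_absorb1)
    then obtain w where w: "w \<in> W" "w \<notin> D" by blast
    show ?thesis
    proof (cases "w \<in> X")
      case True
      have eq: "insert w D \<inter> W = insert w (D \<inter> W)" using w by auto
      have card: "card (insert w D \<inter> W) = Suc (card (D \<inter> W))" unfolding eq using w finW by simp
      moreover have "insert w D - X = D - X" using True by auto
      \<comment> \<open>One vertex raises 3 * card (D \<inter> W), which is below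
        \<open>card W\<close>, by 3; this fits below \<open>2 * card W\<close> because
        \<open>card W \<ge> 3\<close>.\<close>
      ultimately have "Q (insert w D)" unfolding Q_def using Dcl DV w WV False W3 by auto
      then show ?thesis using D(2) card by fastforce
    next
      case False': False
      then obtain B where B: "component_in E (V - X) B" "w \<in> B"
        using component_of_vertex[OF E, of w "V - X"] w WV by blast
      then have BV: "B \<subseteq> V - X" and Bcl: "closed_in E (V - X) B"
        by (auto simp: component_in_def closed_in_def)
      show ?thesis
      proof (cases "card W \<le> 3 * card (B \<inter> W)")
        case True
        have "B - X = B" "B \<subseteq> V" using BV by auto
        then show ?thesis using True small[OF B(1)] Bcl by (intro exI[of _ B]) auto
      next
        case False'': False
        have "card ((D \<union> B) \<inter> W) \<le> card (D \<inter> W) + card (B \<inter> W)"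
          by (simp add: Int_Un_distrib2 card_Un_le)
        then have "3 * card ((D \<union> B) \<inter> W) \<le> 2 * card W" using False False'' by linarith
        moreover have "closed_in E (V - X) (D \<union> B - X)"
          using Dcl Bcl BV unfolding closed_in_def by blast
        ultimately have "Q (D \<union> B)" unfolding Q_def using DV BV by blast
        then have "card ((D \<union> B) \<inter> W) \<le> card (D \<inter> W)" by (rule D(2))
        moreover have "card (D \<inter> W) < card ((D \<union> B) \<inter> W)"
          using w B(2) finW by (intro psubset_card_mono) auto
        ultimately show ?thesis by simp
      qed
    qed
  qed
qed

section \<open>The plane graph of a drawing\<close>

locale drawing =
  fixes H :: "('v, 'e) multigraph" and p :: "'v \<Rightarrow> complex" and \<gamma> :: "'e \<Rightarrow> real \<Rightarrow> complex"
  assumes drawing: "is_drawing H p \<gamma>"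
    and finite_verts: "finite (verts H)" and finite_edges: "finite (edges H)"
    and ends_subset: "e \<in> edges H \<Longrightarrow> ends H e \<subseteq> verts H"
begin

text \<open>
  Turning the crossings into vertices makes the drawing a plane graph, whose edges join consecutive
  points on an edge of \<open>H\<close>.
\<close>

definition points :: "complex set" where
  "points = crossings H p \<gamma> \<union> p ` verts H"

definition consecutive :: "complex set \<Rightarrow> 'e \<Rightarrow> real \<Rightarrow> real \<Rightarrow> bool" where
  "consecutive d e s t \<longleftrightarrow> e \<in> edges H \<and> 0 \<le> s \<and> s < t \<and> t \<le> 1 \<and> d = {\<gamma> e s, \<gamma> e t} \<and>
     d \<subseteq> points \<and> (\<forall>r. s < r \<longrightarrow> r < t \<longrightarrow> \<gamma> e r \<notin> points)"

definition links :: "complex set set" where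
  "links = {d. \<exists>e s t. consecutive d e s t}"

text \<open>Several pieces of edges may join the same two points, for instance parallel edges or
  edges crossing twice. \<open>plane_graph\<close> has one arc for each pair of ends, so one piece
  is chosen; the separator sees adjacency only.\<close>

definition link_arc :: "complex set \<Rightarrow> complex set" where
  "link_arc d = (SOME A. \<exists>e s t. consecutive d e s t \<and> A = \<gamma> e ` {s..t})"

lemma link_arcE:
  assumes "d \<in> links"
  obtains e s t where "consecutive d e s t" "link_arc d = \<gamma> e ` {s..t}"
proof -
  have "\<exists>A e s t. consecutive d e s t \<and> A = \<gamma> e ` {s..t}" using assms by (auto simp: links_def)
  from someI_ex[OF this] show ?thesis using that unfolding link_arc_def by blast
qed

lemma arc_edge: "e \<in> edges H \<Longrightarrow> arc (\<gamma> e)"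
  and ends_edge: "e \<in> edges H \<Longrightarrow> {pathstart (\<gamma> e), pathfinish (\<gamma> e)} = p ` ends H e"
  using drawing by (auto simp: is_drawing_def)

lemma inj_edge: "e \<in> edges H \<Longrightarrow> inj_on (\<gamma> e) {0..1}"
  using arc_edge by (auto simp: arc_def)

lemma finite_points: "finite points"
  using drawing finite_verts by (auto simp: is_drawing_def points_def)

lemma consecutive_arc:
  assumes "consecutive d e s t"
  shows "\<exists>u\<in>points. \<exists>v\<in>points. \<exists>g. d = {u, v} \<and> arc g \<and> pathstart g = u \<and> pathfinish g = v \<and>
      \<gamma> e ` {s..t} = path_image g"
proof -
  have "arc (subpath s t (\<gamma> e))" using assms arc_edge by (intro arc_subpath_arc) (auto simp: consecutive_def)
  moreover have "path_image (subpath s t (\<gamma> e)) = \<gamma> e ` {s..t}"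
    using assms by (intro path_image_subpath_gen[THEN trans]) (auto simp: consecutive_def closed_segment_eq_real_ivl)
  ultimately show ?thesis using assms
    by (intro bexI[of _ "\<gamma> e s"] bexI[of _ "\<gamma> e t"] exI[of _ "subpath s t (\<gamma> e)"])
      (auto simp: consecutive_def)
qed

lemma consecutive_Int_points:
  assumes "consecutive d e s t"
  shows "\<gamma> e ` {s..t} \<inter> points = d"
proof
  show "\<gamma> e ` {s..t} \<inter> points \<subseteq> d"
  proof
    fix x assume "x \<in> \<gamma> e ` {s..t} \<inter> points"
    then obtain r where "s \<le> r" "r \<le> t" "x = \<gamma> e r" "\<gamma> e r \<in> points" by auto
    then show "x \<in> d" using assms unfolding consecutive_def by (cases "r = s \<or> r = t") force+
  qed
  show "d \<subseteq> \<gamma> e ` {s..t} \<inter> points" using assms by (auto simp: consecutive_def)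
qed

text \<open>Distinct edges meet outside the vertices in crossings, which are points. On a single
  edge, overlapping parameter intervals that end at points and have none inside coincide.\<close>

lemma consecutive_Int:
  assumes "consecutive d e s t" "consecutive d' e' s' t'" "d \<noteq> d'"
  shows "\<gamma> e ` {s..t} \<inter> \<gamma> e' ` {s'..t'} \<subseteq> points"
proof
  fix x assume "x \<in> \<gamma> e ` {s..t} \<inter> \<gamma> e' ` {s'..t'}"
  then obtain r r' where r: "s \<le> r" "r \<le> t" "x = \<gamma> e r" and r': "s' \<le> r'" "r' \<le> t'" "x = \<gamma> e' r'"
    by auto
  note c = assms(1,2)[unfolded consecutive_def]
  show "x \<in> points"
  proof (rule ccontr)
    assume x: "x \<notin> points"
    then have "r \<noteq> s" "r \<noteq> t" "r' \<noteq> s'" "r' \<noteq> t'" using c r r' by auto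
    then have r2: "s < r" "r < t" and r2': "s' < r'" "r' < t'" using r r' by auto
    show False
    proof (cases "e = e'")
      case True
      have "r = r'" using inj_edge[of e] r r' c True by (auto simp: inj_on_def)
      then have "s' < t" "s < t'" using r2 r2' by auto
      have P: "\<gamma> e s \<in> points" "\<gamma> e t \<in> points" "\<gamma> e s' \<in> points" "\<gamma> e t' \<in> points"
        using c True by auto
      have gap: "\<gamma> e q \<notin> points" if "s < q \<and> q < t \<or> s' < q \<and> q < t'" for q
        using c True that by blast
      have "s = s'" using P gap[of s] gap[of s'] \<open>s' < t\<close> \<open>s < t'\<close> by (meson linorder_neqE_linordered_idom)
      moreover have "t = t'" using P gap[of t] gap[of t'] \<open>s' < t\<close> \<open>s < t'\<close> by (meson linorder_neqE_linordered_idom)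
      ultimately have "d = d'" using c True by auto
      then show False using assms(3) by simp
    next
      case False
      have "r \<in> {0..1}" "r' \<in> {0..1}" using r r' c by auto
      then have "x \<in> path_image (\<gamma> e)" "x \<in> path_image (\<gamma> e')"
        unfolding path_image_def using r(3) r'(3) by blast+
      then have "x \<in> crossings H p \<gamma>" using False c x by (auto simp: crossings_def points_def)
      then show False using x by (simp add: points_def)
    qed
  qed
qed

sublocale plane_graph points links link_arc
proof
  fix d d' assume d: "d \<in> links"
  obtain e s t where 1: "consecutive d e s t" "link_arc d = \<gamma> e ` {s..t}" using link_arcE[OF d] .
  show "\<exists>u\<in>points. \<exists>v\<in>points. \<exists>g. d = {u, v} \<and> arc g \<and> pathstart g = u \<and> pathfinish g = v \<and>
      link_arc d = path_image g" unfolding 1(2) by (rule consecutive_arc[OF 1(1)])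
  show "link_arc d \<inter> points = d" unfolding 1(2) by (rule consecutive_Int_points[OF 1(1)])
  assume d': "d' \<in> links" "d \<noteq> d'"
  obtain e' s' t' where 2: "consecutive d' e' s' t'" "link_arc d' = \<gamma> e' ` {s'..t'}" using link_arcE[OF d'(1)] .
  show "link_arc d \<inter> link_arc d' \<subseteq> points" unfolding 1(2) 2(2) by (rule consecutive_Int[OF 1(1) 2(1) d'(2)])
qed (rule finite_points)

lemma ends_in_points:
  assumes "e \<in> edges H"
  shows "\<gamma> e 0 \<in> points" "\<gamma> e 1 \<in> points"
proof -
  have "pathstart (\<gamma> e) \<in> p ` ends H e" "pathfinish (\<gamma> e) \<in> p ` ends H e"
    using ends_edge[OF assms] by blast+
  moreover have "p ` ends H e \<subseteq> points" using ends_subset[OF assms] by (auto simp: points_def)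
  ultimately show "\<gamma> e 0 \<in> points" "\<gamma> e 1 \<in> points"
    unfolding pathstart_def pathfinish_def by blast+
qed

text \<open>Let \<open>t\<close> be the last parameter at which the edge is at a point of
  \<open>T\<close>. If \<open>t < 1\<close>, the next point on the edge is linked to it and lies
  outside \<open>X\<close>, so it is in \<open>T\<close> too.\<close>

lemma edge_stays:
  assumes e: "e \<in> edges H" and X: "path_image (\<gamma> e) \<inter> X = {}" and T: "closed_in E (points - X) T"
    and start: "\<gamma> e 0 \<in> T"
  shows "\<gamma> e 1 \<in> T"
proof -
  define Q where "Q = \<gamma> e -` points \<inter> {0..1}"
  have finQ: "finite Q" unfolding Q_def by (rule finite_vimage_IntI[OF finite_points inj_edge[OF e]])
  define S where "S = {t \<in> Q. \<gamma> e t \<in> T}"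
  have "finite S" by (rule finite_subset[OF _ finQ]) (auto simp: S_def)
  moreover have "0 \<in> S" using start ends_in_points[OF e] by (auto simp: S_def Q_def)
  ultimately have S: "finite S" "0 \<in> S" .
  define t where "t = Max S"
  have t: "t \<in> S" "\<And>r. r \<in> S \<Longrightarrow> r \<le> t" 
    unfolding t_def using S(2) Max_in[OF S(1)] Max_ge[OF S(1)] by blast+
  have "t = 1"
  proof (rule ccontr)
    assume "t \<noteq> 1"
    then have t1: "0 \<le> t" "t < 1" using t by (auto simp: S_def Q_def)
    define R where "R = {r \<in> Q. t < r}"
    have "finite R" by (rule finite_subset[OF _ finQ]) (auto simp: R_def)
    moreover have "1 \<in> R" using t1 ends_in_points[OF e] by (auto simp: R_def Q_def)
    ultimately have R: "finite R" "1 \<in> R" .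
    define t' where "t' = Min R"
    have t': "t' \<in> R" "\<And>r. r \<in> R \<Longrightarrow> t' \<le> r" 
      unfolding t'_def using R(2) Min_in[OF R(1)] Min_le[OF R(1)] by blast+
    have "\<gamma> e r \<notin> points" if "t < r" "r < t'" for r
    proof
      assume "\<gamma> e r \<in> points"
      then have "r \<in> R" using that t'(1) t1 by (auto simp: R_def Q_def)
      then show False using t'(2)[of r] that by simp
    qed
    then have "consecutive {\<gamma> e t, \<gamma> e t'} e t t'"
      using t t' t1 e by (auto simp: consecutive_def S_def R_def Q_def)
    then have "{\<gamma> e t, \<gamma> e t'} \<in> links" unfolding links_def by blast
    then have "E (\<gamma> e t) (\<gamma> e t')" by (simp only: E_def)
    moreover have "\<gamma> e t' \<in> path_image (\<gamma> e)" "\<gamma> e t' \<in> points"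
      using t'(1) by (auto simp: R_def Q_def path_image_def)
    then have "\<gamma> e t' \<in> points - X" using X by blast
    moreover have "\<gamma> e t \<in> T" using t by (simp add: S_def)
    ultimately have "\<gamma> e t' \<in> T" using T unfolding closed_in_def by blast
    then have "t' \<in> S" using t'(1) by (auto simp: R_def S_def)
    then show False using t(2)[of t'] t'(1) by (auto simp: R_def)
  qed
  then show ?thesis using t by (simp add: S_def)
qed

lemma edge_start_iff_finish:
  assumes e: "e \<in> edges H" and X: "path_image (\<gamma> e) \<inter> X = {}" and T: "closed_in E (points - X) T"
  shows "\<gamma> e 0 \<in> T \<longleftrightarrow> \<gamma> e 1 \<in> T"
proof
  assume f: "\<gamma> e 1 \<in> T"
  have "closed_in E (points - X) (points - X)" by (simp add: closed_in_def)
  from closed_in_Diff[OF symp_E this T] have "closed_in E (points - X) (points - X - T)" .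
  from edge_stays[OF e X this] f have "\<gamma> e 0 \<notin> points - X - T" by blast
  moreover have "\<gamma> e 0 \<in> path_image (\<gamma> e)" by (auto simp: path_image_def)
  ultimately show "\<gamma> e 0 \<in> T" using X ends_in_points[OF e] by blast
qed (rule edge_stays[OF assms])

lemma boundary_edge_meets_separator:
  assumes D: "closed_in E (points - X) (D - X)" and e: "e \<in> edge_boundary H {v \<in> verts H. p v \<in> D}"
  shows "path_image (\<gamma> e) \<inter> X \<noteq> {}"
proof
  assume X: "path_image (\<gamma> e) \<inter> X = {}"
  obtain u v where uv: "e \<in> edges H" "ends H e = {u, v}" "u \<in> verts H" "p u \<in> D" "\<not> (v \<in> verts H \<and> p v \<in> D)"
    using e by (auto simp: edge_boundary_def)
  have v: "v \<in> verts H" "p v \<notin> D" using uv ends_subset[of e] by auto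
  have "{\<gamma> e 0, \<gamma> e 1} = {p u, p v}"
    using ends_edge[OF uv(1)] uv(2) by (simp add: pathstart_def pathfinish_def)
  moreover have "\<gamma> e 0 \<notin> X" "\<gamma> e 1 \<notin> X" using X
    by (auto simp: path_image_def dest!: disjoint_iff[THEN iffD1])
  ultimately show False using edge_start_iff_finish[OF uv(1) X D] uv(4) v(2)
    by (auto simp: doubleton_eq_iff)
qed

lemma card_edges_through_point:
  assumes deg: "\<And>v. v \<in> verts H \<Longrightarrow> card {e \<in> edges H. v \<in> ends H e} \<le> \<Delta>" and "\<Delta> \<ge> 2" "x \<in> points"
  shows "card {e \<in> edges H. x \<in> path_image (\<gamma> e)} \<le> \<Delta>"
proof (cases "x \<in> p ` verts H")
  case True
  then obtain v where v: "v \<in> verts H" "x = p v" by blast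
  have "{e \<in> edges H. x \<in> path_image (\<gamma> e)} \<subseteq> {e \<in> edges H. v \<in> ends H e}"
    using drawing v by (auto simp: is_drawing_def)
  then have "card {e \<in> edges H. x \<in> path_image (\<gamma> e)} \<le> card {e \<in> edges H. v \<in> ends H e}"
    using finite_edges by (intro card_mono) auto
  then show ?thesis using deg[OF v(1)] by simp
next
  case False
  then have "x \<in> crossings H p \<gamma>" using assms(3) by (auto simp: points_def)
  then show ?thesis using drawing assms(2) by (auto simp: is_drawing_def)
qed

text \<open>\<rho> bounds the square root of the number of all points, while the weight set consists
  of the drawn vertices of \<open>H\<close>. The 36 is h^2 for h = 6.\<close>

theorem balanced_cut:
  assumes deg: "\<And>v. v \<in> verts H \<Longrightarrow> card {e \<in> edges H. v \<in> ends H e} \<le> \<Delta>" "\<Delta> \<ge> 2"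
    and "card (verts H) \<ge> 3" and \<rho>: "card (crossings H p \<gamma>) + card (verts H) \<le> \<rho> * \<rho>"
  shows "\<exists>U\<subseteq>verts H. card (verts H) \<le> 3 * card U \<and> 3 * card U \<le> 2 * card (verts H) \<and>
    card (edge_boundary H U) \<le> 36 * Suc \<rho> * \<Delta>"
proof -
  let ?W = "p ` verts H"
  have inj: "inj_on p (verts H)" using drawing by (simp add: is_drawing_def)
  have cardW: "card ?W = card (verts H)" by (rule card_image[OF inj])
  have "card points \<le> card (crossings H p \<gamma>) + card ?W" unfolding points_def by (rule card_Un_le)
  then have "card points \<le> \<rho> * \<rho>" using \<rho> cardW by simp
  moreover have "\<rho> > 0" using \<rho> assms(3) by (cases \<rho>) auto
  ultimately obtain X where X: "X \<subseteq> points" "card X \<le> 6 * (6 * Suc \<rho>)"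
    "\<And>B. component_in E (points - X) B \<Longrightarrow> 2 * card (B \<inter> ?W) \<le> card ?W"
    using separator[OF symp_E finite_points, of ?W \<rho> 6] no_covey_6 finite_verts by auto
  have "?W \<subseteq> points" by (auto simp: points_def)
  from balanced_union_of_components[OF symp_E finite_points this X(1) _ X(3)] assms(3) cardW
  obtain D where D: "D \<subseteq> points" "closed_in E (points - X) (D - X)"
    "card ?W \<le> 3 * card (D \<inter> ?W)" "3 * card (D \<inter> ?W) \<le> 2 * card ?W" by auto
  let ?U = "{v \<in> verts H. p v \<in> D}"
  have "card ?U = card (p ` ?U)" by (rule card_image[symmetric, OF inj_on_subset[OF inj]]) auto
  also have "p ` ?U = D \<inter> ?W" by auto
  finally have U: "card (verts H) \<le> 3 * card ?U" "3 * card ?U \<le> 2 * card (verts H)" using D cardW by auto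
  have finX: "finite X" using X(1) finite_points finite_subset by blast
  have "edge_boundary H ?U \<subseteq> (\<Union>x\<in>X. {e \<in> edges H. x \<in> path_image (\<gamma> e)})"
    using boundary_edge_meets_separator[OF D(2)] by (fastforce simp: edge_boundary_def)
  then have "card (edge_boundary H ?U) \<le> card (\<Union>x\<in>X. {e \<in> edges H. x \<in> path_image (\<gamma> e)})"
    using finX finite_edges by (intro card_mono) auto
  also have "\<dots> \<le> (\<Sum>x\<in>X. card {e \<in> edges H. x \<in> path_image (\<gamma> e)})" by (rule card_UN_le[OF finX])
  also have "\<dots> \<le> card X * \<Delta>"
  proof (rule sum_bounded_above[of X _ \<Delta>, simplified])
    fix x assume "x \<in> X"
    then show "card {e \<in> edges H. x \<in> path_image (\<gamma> e)} \<le> \<Delta>"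
      using X(1) by (intro card_edges_through_point[OF deg]) auto
  qed
  also have "\<dots> \<le> 36 * Suc \<rho> * \<Delta>" using X(2) by (intro mult_le_mono1) simp
  finally show ?thesis using U by (intro exI[of _ ?U]) auto
qed

end

section \<open>Random orderings\<close>

definition changes :: "nat \<Rightarrow> nat set \<Rightarrow> nat set" where
  "changes L U = {i. Suc i < L \<and> (i \<in> U \<longleftrightarrow> Suc i \<notin> U)}"

definition few_changes :: "real \<Rightarrow> nat \<Rightarrow> nat set set" where
  "few_changes m L = {U. U \<subseteq> {..<L} \<and> real (card (changes L U)) < m}"

lemma changes_inj:
  assumes "U \<subseteq> {..<L}" "V \<subseteq> {..<L}" "0 \<in> U \<longleftrightarrow> 0 \<in> V" "changes L U = changes L V"
  shows "U = V"
proof -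
  have "i < L \<Longrightarrow> i \<in> U \<longleftrightarrow> i \<in> V" for i
  proof (induction i)
    case (Suc i)
    have "i \<in> changes L U \<longleftrightarrow> i \<in> changes L V" using assms(4) by simp
    with Suc show ?case by (auto simp: changes_def)
  qed (use assms in simp)
  then show ?thesis using assms(1,2) by blast
qed

text \<open>
  Chernoff's argument: each counted \<open>D\<close> has \<open>x powr (card D - m) \<ge> 1\<close>.
\<close>

lemma card_few_subsets_le:
  fixes x m :: real
  assumes "0 < x" "x \<le> 1"
  shows "real (card {D. D \<subseteq> {..<L} \<and> real (card D) < m}) \<le> x powr (- m) * (1 + x) ^ L"
proof -
  let ?S = "{D. D \<subseteq> {..<L} \<and> real (card D) < m}"
  have "real (card ?S) = (\<Sum>D\<in>?S. 1)" by simp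
  also have "\<dots> \<le> (\<Sum>D\<in>?S. x powr (- m) * x ^ card D)"
  proof (rule sum_mono)
    fix D assume "D \<in> ?S"
    then have "x powr m \<le> x powr real (card D)" using assms by (intro powr_mono') auto
    then show "1 \<le> x powr (- m) * x ^ card D"
      using assms by (simp add: powr_minus powr_realpow field_simps)
  qed
  also have "\<dots> \<le> (\<Sum>D\<in>Pow {..<L}. x powr (- m) * x ^ card D)"
    using assms by (intro sum_mono2) auto
  also have "\<dots> = x powr (- m) * (\<Sum>D\<in>Pow {..<L}. x ^ card D)" by (simp add: sum_distrib_left)
  also have "(\<Sum>D\<in>Pow {..<L}. x ^ card D) = (\<Prod>i<L. x + 1)"
    by (subst prod_add) auto
  finally show ?thesis by (simp add: add.commute)
qed

text \<open>The factor 2 counts the first letter of the indicator word, which together with the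
  changes determines it.\<close>

lemma card_few_changes_le:
  fixes x m :: real
  assumes "0 < x" "x \<le> 1"
  shows "real (card (few_changes m L)) \<le> 2 * (x powr (- m) * (1 + x) ^ L)"
proof -
  let ?S = "{D. D \<subseteq> {..<L} \<and> real (card D) < m}"
  have fin: "finite ?S" by (rule finite_subset[of _ "Pow {..<L}"]) auto
  have "card (few_changes m L) \<le> card ((UNIV :: bool set) \<times> ?S)"
  proof (rule card_inj_on_le)
    show "inj_on (\<lambda>U. (0 \<in> U, changes L U)) (few_changes m L)"
      using changes_inj[of _ L] unfolding inj_on_def few_changes_def by blast
    show "(\<lambda>U. (0 \<in> U, changes L U)) ` few_changes m L \<subseteq> UNIV \<times> ?S"
      by (auto simp: few_changes_def changes_def)
  qed (use fin in simp)
  then have "real (card (few_changes m L)) \<le> 2 * real (card ?S)"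
    by (simp add: card_cartesian_product)
  then show ?thesis using card_few_subsets_le[OF assms, of L m] by simp
qed

section \<open>Position sets in an ordering\<close>

text \<open>
  The edges of the second path leaving \<open>U\<close> are the changes of the set of positions of the elements
  of \<open>U\<close>, which is a uniformly random set of the same size as \<open>U\<close>.
\<close>

definition positions :: "nat list \<Rightarrow> nat set \<Rightarrow> nat set" where
  "positions \<sigma> U = {i. i < length \<sigma> \<and> \<sigma> ! i \<in> U}"

text \<open>Read from the front, the pattern of \<open>P\<close> tells which of the two filtered
  lists supplies the next entry.\<close>

lemma merge_unique:
  assumes "length xs = length ys" "\<And>i. i < length xs \<Longrightarrow> P (xs ! i) \<longleftrightarrow> P (ys ! i)"
    "filter P xs = filter P ys" "filter (\<lambda>x. \<not> P x) xs = filter (\<lambda>x. \<not> P x) ys"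
  shows "xs = ys"
  using assms
proof (induction xs ys rule: list_induct2)
  case (Cons x xs y ys)
  have "P x \<longleftrightarrow> P y" using Cons.prems(1)[of 0] by simp
  moreover have "P (xs ! i) \<longleftrightarrow> P (ys ! i)" if "i < length xs" for i
    using Cons.prems(1)[of "Suc i"] that by simp
  ultimately show ?case using Cons.IH Cons.prems(2,3) by (auto split: if_splits)
qed simp

text \<open>Once the position set is fixed, an ordering is determined by the orders it induces on
  \<open>U\<close> and on the complement. So a position set has probability at most 1 / (L choose
  card U).\<close>

lemma card_orderings_with_positions_le:
  assumes "U \<subseteq> {..<L}"
  shows "card {\<sigma> \<in> permutations_of_set {..<L}. positions \<sigma> U = U'} \<le> fact (card U) * fact (L - card U)"
proof -
  let ?S = "{\<sigma> \<in> permutations_of_set {..<L}. positions \<sigma> U = U'}"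
  have finU: "finite U" using assms finite_subset by blast
  have "card ?S \<le> card (permutations_of_set U \<times> permutations_of_set ({..<L} - U))"
  proof (rule card_inj_on_le)
    show "inj_on (\<lambda>\<sigma>. (filter (\<lambda>x. x \<in> U) \<sigma>, filter (\<lambda>x. x \<notin> U) \<sigma>)) ?S"
    proof (rule inj_onI)
      fix \<sigma> \<tau> assume "\<sigma> \<in> ?S" "\<tau> \<in> ?S"
        and eq: "(filter (\<lambda>x. x \<in> U) \<sigma>, filter (\<lambda>x. x \<notin> U) \<sigma>) = (filter (\<lambda>x. x \<in> U) \<tau>, filter (\<lambda>x. x \<notin> U) \<tau>)"
      then have "length \<sigma> = length \<tau>" and "positions \<sigma> U = positions \<tau> U"
        by (auto simp: length_finite_permutations_of_set)
      then show "\<sigma> = \<tau>" using eq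
        by (intro merge_unique[of \<sigma> \<tau> "\<lambda>x. x \<in> U"]) (auto simp: positions_def)
    qed
    show "(\<lambda>\<sigma>. (filter (\<lambda>x. x \<in> U) \<sigma>, filter (\<lambda>x. x \<notin> U) \<sigma>)) ` ?S
        \<subseteq> permutations_of_set U \<times> permutations_of_set ({..<L} - U)"
      using assms by (auto simp: permutations_of_set_def)
  qed (use finU in simp)
  also have "\<dots> = fact (card U) * fact (L - card U)"
    using assms finU by (simp add: card_cartesian_product card_Diff_subset)
  finally show ?thesis .
qed

lemma card_positions:
  assumes "\<sigma> \<in> permutations_of_set {..<L}" "U \<subseteq> {..<L}"
  shows "card (positions \<sigma> U) = card U" "positions \<sigma> U \<subseteq> {..<L}"
proof -
  have \<sigma>: "distinct \<sigma>" "set \<sigma> = {..<L}" "length \<sigma> = L"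
    using assms(1) by (auto simp: permutations_of_set_def length_finite_permutations_of_set)
  have "(!) \<sigma> ` positions \<sigma> U = U"
  proof
    show "U \<subseteq> (!) \<sigma> ` positions \<sigma> U"
    proof
      fix u assume u: "u \<in> U"
      then have "u \<in> set \<sigma>" using \<sigma>(2) assms(2) by blast
      then obtain i where "i < length \<sigma>" "\<sigma> ! i = u" by (auto simp: in_set_conv_nth)
      then show "u \<in> (!) \<sigma> ` positions \<sigma> U" using u by (auto simp: positions_def)
    qed
  qed (auto simp: positions_def)
  moreover have "inj_on ((!) \<sigma>) (positions \<sigma> U)"
    using \<sigma>(1) by (auto simp: inj_on_def positions_def nth_eq_iff_index_eq)
  ultimately show "card (positions \<sigma> U) = card U" by (metis card_image)
  show "positions \<sigma> U \<subseteq> {..<L}" using \<sigma> by (auto simp: positions_def)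
qed

lemma pair_eq_crossing:
  "(\<exists>u v. {a, b} = {u, v} \<and> u \<in> U \<and> v \<notin> U) \<longleftrightarrow> (a \<in> U \<longleftrightarrow> b \<notin> U)"
  by (auto simp: doubleton_eq_iff)

lemma card_edge_boundary_path_pair:
  assumes "length \<sigma> = L"
  shows "card (edge_boundary (path_pair \<sigma>) U) = card (changes L U) + card (changes L (positions \<sigma> U))"
proof -
  have fin: "finite (changes L V)" for V by (rule finite_subset[of _ "{..<L}"]) (auto simp: changes_def)
  have "edge_boundary (path_pair \<sigma>) U = changes L U <+> changes L (positions \<sigma> U)"
  proof (rule set_eqI)
    fix e show "e \<in> edge_boundary (path_pair \<sigma>) U \<longleftrightarrow> e \<in> changes L U <+> changes L (positions \<sigma> U)"
      using assms by (cases e)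
        (auto simp: edge_boundary_def path_pair_def changes_def positions_def pair_eq_crossing)
  qed
  then show ?thesis using fin by (simp add: card_Plus)
qed

text \<open>By symmetry \<open>2 * k \<le> L\<close>, and then (L / k)^k \<ge> 2^k. The case
  \<open>j = 0\<close> of the inner claim forces \<open>L = 0\<close>.\<close>

lemma binomial_ge_exp:
  assumes "real L / 3 \<le> real k" "real k \<le> 2 * real L / 3"
  shows "real (L choose k) \<ge> 2 powr (real L / 3)"
proof -
  have half: "real (L choose j) \<ge> 2 powr (real L / 3)" if "real L / 3 \<le> real j" "2 * j \<le> L" for j
  proof (cases "j = 0")
    case False
    have "2 powr (real L / 3) \<le> 2 powr (real j)" using that by (intro powr_mono) auto
    also have "\<dots> = 2 ^ j" by (simp add: powr_realpow)
    also have "\<dots> \<le> (real L / real j) ^ j" using that False by (intro power_mono) (auto simp: field_simps)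
    also have "\<dots> \<le> real (L choose j)" using that by (intro binomial_ge_n_over_k_pow_k) auto
    finally show ?thesis .
  qed (use that in auto)
  show ?thesis
  proof (cases "2 * k \<le> L")
    case True
    then show ?thesis using half assms by blast
  next
    case False
    have "k \<le> L" using assms by linarith
    then have "(L choose k) = (L choose (L - k))" by (rule binomial_symmetric)
    moreover have "real L / 3 \<le> real (L - k)" "2 * (L - k) \<le> L"
      using assms False \<open>k \<le> L\<close> by (auto simp: of_nat_diff)
    ultimately show ?thesis using half by metis
  qed
qed

section \<open>The probability estimate\<close>

definition bad_orderings :: "real \<Rightarrow> nat \<Rightarrow> nat list set" where
  "bad_orderings \<eta> L = {\<sigma>. \<exists>U\<subseteq>{..<L}. real L / 3 \<le> real (card U) \<and> real (card U) \<le> 2 * real L / 3 \<and>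
     real (card (edge_boundary (path_pair \<sigma>) U)) < \<eta> * real L}"

lemma prob_bad_orderings_le:
  "measure_pmf.prob (random_ordering L) (bad_orderings \<eta> L)
    \<le> (real (card (few_changes (\<eta> * real L) L)))\<^sup>2 * 2 powr (- real L / 3)"
proof -
  let ?S = "permutations_of_set {..<L}" and ?F = "few_changes (\<eta> * real L) L"
  let ?P = "{(U, U') \<in> ?F \<times> ?F. card U = card U' \<and> real L / 3 \<le> real (card U) \<and> real (card U) \<le> 2 * real L / 3}"
  let ?O = "\<lambda>(U, U'). {\<sigma> \<in> ?S. positions \<sigma> U = U'}"
  have finF: "finite ?F" by (rule finite_subset[of _ "Pow {..<L}"]) (auto simp: few_changes_def)
  then have finP: "finite ?P" by (auto intro: finite_subset[of _ "?F \<times> ?F"])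
  have cover: "?S \<inter> bad_orderings \<eta> L \<subseteq> (\<Union>p\<in>?P. ?O p)"
  proof
    fix \<sigma> assume \<sigma>: "\<sigma> \<in> ?S \<inter> bad_orderings \<eta> L"
    then obtain U where U: "U \<subseteq> {..<L}" "real L / 3 \<le> real (card U)" "real (card U) \<le> 2 * real L / 3"
      "real (card (edge_boundary (path_pair \<sigma>) U)) < \<eta> * real L"
      by (auto simp: bad_orderings_def)
    have "length \<sigma> = L" using \<sigma> by (auto simp: length_finite_permutations_of_set)
    from card_edge_boundary_path_pair[OF this, of U] U(4)
    have "U \<in> ?F" "positions \<sigma> U \<in> ?F"
      using U(1) card_positions[OF _ U(1), of \<sigma>] \<sigma> by (auto simp: few_changes_def)
    moreover have "card (positions \<sigma> U) = card U" using card_positions[OF _ U(1), of \<sigma>] \<sigma> by auto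
    ultimately show "\<sigma> \<in> (\<Union>p\<in>?P. ?O p)" using \<sigma> U by auto
  qed
  have each: "real (card (?O p)) \<le> fact L * 2 powr (- real L / 3)" if "p \<in> ?P" for p
  proof -
    obtain U U' where pU: "p = (U, U')" by (cases p)
    have p: "p = (U, U')" "U \<subseteq> {..<L}" "real L / 3 \<le> real (card U)" "real (card U) \<le> 2 * real L / 3"
      using that pU by (auto simp: few_changes_def)
    have k: "card U \<le> L" using p(2) card_mono[of "{..<L}" U] by simp
    have "real (card (?O p)) \<le> real (fact (card U) * fact (L - card U))"
      using card_orderings_with_positions_le[OF p(2), of U'] p(1) by (simp only: of_nat_le_iff prod.case)
    also have "\<dots> = fact L / real (L choose card U)"
      using binomial_fact_lemma[OF k, THEN arg_cong[of _ _ real]] k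
      by (simp add: field_simps zero_less_binomial_iff)
    also have "\<dots> \<le> fact L / 2 powr (real L / 3)"
      using binomial_ge_exp[OF p(3,4)] k
      by (intro divide_left_mono mult_pos_pos) (auto simp: zero_less_binomial_iff)
    finally show ?thesis by (simp add: powr_minus divide_simps)
  qed
  have "real (card (?S \<inter> bad_orderings \<eta> L)) \<le> real (card (\<Union>p\<in>?P. ?O p))"
    using finP by (intro of_nat_mono card_mono cover) auto
  also have "\<dots> \<le> (\<Sum>p\<in>?P. real (card (?O p)))"
    unfolding of_nat_sum[symmetric] of_nat_le_iff by (rule card_UN_le[OF finP])
  also have "\<dots> \<le> real (card ?P) * (fact L * 2 powr (- real L / 3))"
    using each by (rule sum_bounded_above)
  also have "\<dots> \<le> (real (card ?F))\<^sup>2 * (fact L * 2 powr (- real L / 3))"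
  proof (rule mult_right_mono)
    have "card ?P \<le> card (?F \<times> ?F)" using finF by (intro card_mono) auto
    then show "real (card ?P) \<le> (real (card ?F))\<^sup>2"
      by (simp add: card_cartesian_product power2_eq_square flip: of_nat_mult)
  qed simp
  finally have "real (card (?S \<inter> bad_orderings \<eta> L)) / fact L \<le> (real (card ?F))\<^sup>2 * 2 powr (- real L / 3)"
    by (simp add: field_simps)
  moreover have "measure_pmf.prob (random_ordering L) (bad_orderings \<eta> L) = real (card (?S \<inter> bad_orderings \<eta> L)) / fact L"
    unfolding random_ordering_def by (subst measure_pmf_of_set) (auto simp: permutations_of_set_empty_iff)
  ultimately show ?thesis by simp
qed

text \<open>With x = 1/100 a word costs a factor exp (17/1000 L): 7/1000 from
  \<open>ln 100 \<le> 7\<close> and 1/100 from 1 + x. A pair of words costs twice the exponent,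
  34/1000, against the gain 2/9 from \<open>ln 2 \<ge> 2/3\<close>. The remaining factor 4 is below
  exp (4/100 L) for L > 100, and 34/1000 + 4/100 - 2/9 < -1/10.\<close>

lemma prob_bad_orderings_less:
  assumes "L > 100"
  shows "measure_pmf.prob (random_ordering L) (bad_orderings (1 / 1000) L) < exp (- (1 / 10) * real L)"
proof -
  let ?N = "real (card (few_changes (1 / 1000 * real L) L))"
  have "ln (100 :: real) \<le> ln (2 ^ 7)" by (subst ln_le_cancel_iff) auto
  also have "\<dots> = 7 * ln 2" by (rule ln_realpow[of 2 7, simplified of_nat_numeral])
  also have "\<dots> \<le> 7" using ln_le_minus_one[of "2 :: real"] by simp
  finally have ln100: "ln (100 :: real) \<le> 7" .
  have "(1 / 100 :: real) powr (- (1 / 1000 * real L)) = exp (real L / 1000 * ln 100)"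
    by (simp add: powr_def ln_div)
  also have "\<dots> \<le> exp (real L / 1000 * 7)"
    using ln100 by (intro iffD2[OF exp_le_cancel_iff] mult_left_mono) auto
  finally have A: "(1 / 100 :: real) powr (- (1 / 1000 * real L)) \<le> exp (real L / 1000 * 7)" .
  have "(1 + 1 / 100 :: real) ^ L \<le> exp (1 / 100) ^ L"
    by (intro power_mono exp_ge_add_one_self) auto
  also have "\<dots> = exp (real L / 100)" by (simp add: exp_of_nat_mult flip: exp_of_nat2_mult)
  finally have B: "(1 + 1 / 100 :: real) ^ L \<le> exp (real L / 100)" .
  have "?N \<le> 2 * ((1 / 100) powr (- (1 / 1000 * real L)) * (1 + 1 / 100) ^ L)"
    by (rule card_few_changes_le) auto
  also have "\<dots> \<le> 2 * (exp (real L / 1000 * 7) * exp (real L / 100))"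
    using A B by (intro mult_left_mono mult_mono) auto
  also have "\<dots> = 2 * exp (17 / 1000 * real L)" by (simp flip: exp_add)
  finally have N: "?N\<^sup>2 \<le> (2 * exp (17 / 1000 * real L))\<^sup>2" by (intro power_mono) auto
  have "(2 :: real) powr (- real L / 3) = exp (- real L / 3 * ln 2)" by (simp add: powr_def)
  also have "\<dots> \<le> exp (- (2 / 9) * real L)"
    using mult_left_mono[OF ln2_ge_two_thirds, of "real L / 3"] by simp
  finally have C: "(2 :: real) powr (- real L / 3) \<le> exp (- (2 / 9) * real L)" .
  have "measure_pmf.prob (random_ordering L) (bad_orderings (1 / 1000) L) \<le> ?N\<^sup>2 * 2 powr (- real L / 3)"
    by (rule prob_bad_orderings_le)
  also have "\<dots> \<le> (2 * exp (17 / 1000 * real L))\<^sup>2 * exp (- (2 / 9) * real L)"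
    using N C by (intro mult_mono) auto
  also have "\<dots> = 4 * exp ((34 / 1000 - 2 / 9) * real L)"
    by (simp add: power_mult_distrib algebra_simps flip: exp_add exp_double)
  also have "\<dots> < exp (4 / 100 * real L) * exp ((34 / 1000 - 2 / 9) * real L)"
  proof (rule mult_strict_right_mono)
    show "4 < exp (4 / 100 * real L)" using exp_ge_add_one_self[of "4 / 100 * real L"] assms by linarith
  qed simp
  also have "\<dots> \<le> exp (- (1 / 10) * real L)" by (simp flip: exp_add)
  finally show ?thesis .
qed

section \<open>Crossing numbers of path pairs\<close>

lemma degree_path_pair:
  assumes "distinct \<sigma>"
  shows "card {e \<in> edges (path_pair \<sigma>). v \<in> ends (path_pair \<sigma>) e} \<le> 4"
proof -
  have *: "card {i. i < n - 1 \<and> (f i = v \<or> f (Suc i) = v)} \<le> 2" if "inj_on f {..<n}"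
    for n and f :: "nat \<Rightarrow> nat"
  proof -
    \<comment> \<open>The vertex \<open>v\<close> occurs at most once on the path, so an edge at
      \<open>v\<close> is determined by whether it starts there or ends there.\<close>
    have "card {i. i < n - 1 \<and> (f i = v \<or> f (Suc i) = v)} \<le> card (UNIV :: bool set)"
    proof (rule card_inj_on_le)
      show "inj_on (\<lambda>i. f i = v) {i. i < n - 1 \<and> (f i = v \<or> f (Suc i) = v)}"
      proof (rule inj_onI)
        fix i j assume i: "i \<in> {i. i < n - 1 \<and> (f i = v \<or> f (Suc i) = v)}"
          and j: "j \<in> {i. i < n - 1 \<and> (f i = v \<or> f (Suc i) = v)}" and eq: "(f i = v) = (f j = v)"
        show "i = j"
        proof (cases "f i = v")
          case True
          then show ?thesis using inj_onD[OF that, of i j] i j eq by auto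
        next
          case False
          then show ?thesis using inj_onD[OF that, of "Suc i" "Suc j"] i j eq by auto
        qed
      qed
    qed auto
    then show ?thesis by simp
  qed
  let ?n = "length \<sigma>"
  let ?S = "{i. i < ?n - 1 \<and> (i = v \<or> Suc i = v)}"
  let ?T = "{i. i < ?n - 1 \<and> (\<sigma> ! i = v \<or> \<sigma> ! Suc i = v)}"
  have "{e \<in> edges (path_pair \<sigma>). v \<in> ends (path_pair \<sigma>) e} = ?S <+> ?T"
  proof (rule set_eqI)
    fix e show "e \<in> {e \<in> edges (path_pair \<sigma>). v \<in> ends (path_pair \<sigma>) e} \<longleftrightarrow> e \<in> ?S <+> ?T"
      by (cases e) (auto simp: path_pair_def)
  qed
  moreover have "card ?S \<le> 2" using *[of "\<lambda>i. i" ?n] by simp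
  moreover have "card ?T \<le> 2" using *[of "(!) \<sigma>" ?n] assms by (simp add: inj_on_nth)
  ultimately show ?thesis by (simp add: card_Plus)
qed

lemma drawing_path_pair:
  assumes "\<sigma> \<in> permutations_of_set {..<L}" "is_drawing (path_pair \<sigma>) p \<gamma>"
  shows "drawing (path_pair \<sigma>) p \<gamma>"
proof
  have \<sigma>: "set \<sigma> = {..<L}" "length \<sigma> = L"
    using assms(1) by (auto simp: permutations_of_set_def length_finite_permutations_of_set)
  have "\<sigma> ! i < L" if "i < L" for i using \<sigma> that nth_mem by blast
  then show "ends (path_pair \<sigma>) e \<subseteq> verts (path_pair \<sigma>)" if "e \<in> edges (path_pair \<sigma>)" for e
    using that \<sigma>(2) by (cases e) (auto simp: path_pair_def)
qed (use assms(2) in \<open>auto simp: path_pair_def\<close>)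

lemma few_crossings_imp_bad:
  assumes \<sigma>: "\<sigma> \<in> permutations_of_set {..<L}" and L: "L \<ge> 10 ^ 12"
    and dr: "is_drawing (path_pair \<sigma>) p \<gamma>"
    and few: "real (card (crossings (path_pair \<sigma>) p \<gamma>)) < 1 / 10 ^ 12 * (real L)\<^sup>2"
  shows "\<sigma> \<in> bad_orderings (1 / 1000) L"
proof -
  interpret drawing "path_pair \<sigma>" p \<gamma> by (rule drawing_path_pair[OF \<sigma> dr])
  have "distinct \<sigma>" "length \<sigma> = L"
    using \<sigma> by (auto simp: permutations_of_set_def length_finite_permutations_of_set)
  then have verts: "verts (path_pair \<sigma>) = {..<L}" by (simp add: path_pair_def)
  let ?k = "card (crossings (path_pair \<sigma>) p \<gamma>)"
  \<comment> \<open>For L \<ge> 10^12 both the crossings and the vertices number at most L^2 /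
    10^12, so their sum is below (2 L / 10^6)^2. The cut then has at most 36 * 4 * (\<rho> + 1)
    edges, about 0.0003 L, which is less than L / 1000.\<close>
  define \<rho> where "\<rho> = nat \<lceil>2 / 10 ^ 6 * real L\<rceil>"
  have \<rho>: "2 / 10 ^ 6 * real L \<le> real \<rho>" "real \<rho> \<le> 2 / 10 ^ 6 * real L + 1"
  proof -
    have "0 \<le> \<lceil>2 / 10 ^ 6 * real L\<rceil>" by simp
    then have "real \<rho> = real_of_int \<lceil>2 / 10 ^ 6 * real L\<rceil>" unfolding \<rho>_def by (rule of_nat_nat)
    then show "2 / 10 ^ 6 * real L \<le> real \<rho>" "real \<rho> \<le> 2 / 10 ^ 6 * real L + 1" by linarith+
  qed
  have "real L * 10 ^ 12 \<le> real L * real L" using L by (intro mult_left_mono) (auto simp flip: of_nat_le_iff)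
  then have "real ?k + real L \<le> (2 / 10 ^ 6 * real L)\<^sup>2" using few by (simp add: power2_eq_square)
  also have "\<dots> \<le> (real \<rho>)\<^sup>2" using \<rho>(1) by (intro power_mono) auto
  finally have "?k + L \<le> \<rho> * \<rho>" by (simp add: power2_eq_square flip: of_nat_mult of_nat_add)
  moreover have "card {e \<in> edges (path_pair \<sigma>). v \<in> ends (path_pair \<sigma>) e} \<le> 4" for v
    by (rule degree_path_pair[OF \<open>distinct \<sigma>\<close>])
  ultimately obtain U where U: "U \<subseteq> {..<L}" "L \<le> 3 * card U" "3 * card U \<le> 2 * L"
    "card (edge_boundary (path_pair \<sigma>) U) \<le> 36 * Suc \<rho> * 4"
    using balanced_cut[of 4 \<rho>] L verts by auto
  have "real (card (edge_boundary (path_pair \<sigma>) U)) \<le> 144 * (real \<rho> + 1)"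
    using U(4) by (simp flip: of_nat_le_iff)
  also have "\<dots> \<le> 144 * (2 / 10 ^ 6 * real L + 2)" using \<rho>(2) by simp
  also have "\<dots> < 1 / 1000 * real L"
  proof -
    have "10 ^ 12 \<le> real L" using L by (simp flip: of_nat_le_iff)
    then show ?thesis by simp
  qed
  finally show ?thesis
    using U unfolding bad_orderings_def by (intro CollectI exI[of _ U]) auto
qed

lemma crossing_number_ge:
  assumes "\<And>p \<gamma>. is_drawing H p \<gamma> \<Longrightarrow> c \<le> real (card (crossings H p \<gamma>))"
  shows "ereal c \<le> ereal_of_enat (crossing_number H)"
proof -
  let ?S = "{enat (card (crossings H p \<gamma>)) | p \<gamma>. is_drawing H p \<gamma>}"
  show ?thesis
  proof (cases "?S = {}")
    \<comment> \<open>Without a drawing the infimum is \<infinity>; otherwise it is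
      attained.\<close>
    case True
    then show ?thesis by (simp add: crossing_number_def Inf_enat_def)
  next
    case False
    then have "(LEAST x. x \<in> ?S) \<in> ?S" by (metis (no_types, lifting) LeastI ex_in_conv)
    then have "crossing_number H \<in> ?S"
      unfolding crossing_number_def Inf_enat_def using False by simp
    then obtain p \<gamma> where "is_drawing H p \<gamma>" "crossing_number H = enat (card (crossings H p \<gamma>))" by blast
    then show ?thesis using assms by simp
  qed
qed

lemma large_crossing_number:
  assumes "\<sigma> \<in> permutations_of_set {..<L}" "L \<ge> 10 ^ 12" "\<sigma> \<notin> bad_orderings (1 / 1000) L"
  shows "ereal (1 / 10 ^ 12 * (real L)\<^sup>2) \<le> ereal_of_enat (crossing_number (path_pair \<sigma>))"
  using few_crossings_imp_bad[OF assms(1,2)] assms(3) by (intro crossing_number_ge) (meson not_le)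

theorem theorem18:
  "\<exists>\<eta>::real. \<eta> > 0 \<and>
     (\<exists>L\<^sub>0::nat. \<exists>b::real. L\<^sub>0 > 0 \<and> b > 0 \<and>
        (\<forall>L>L\<^sub>0.
           measure_pmf.prob (random_ordering L)
             {\<sigma>. \<exists>U\<subseteq>{..<L}. real L / 3 \<le> real (card U) \<and> real (card U) \<le> 2 * real L / 3 \<and>
                    real (card (edge_boundary (path_pair \<sigma>) U)) < \<eta> * real L}
           < exp (- b * real L))) \<and>
     (\<exists>c::real. c > 0 \<and>
        (\<forall>\<^sub>F L in sequentially. \<exists>\<sigma>\<in>permutations_of_set {..<L}.
           ereal_of_enat (crossing_number (path_pair \<sigma>)) \<ge> ereal (c * (real L)\<^sup>2)) \<and>
        (\<lambda>L. measure_pmf.prob (random_ordering L)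
               {\<sigma>. ereal_of_enat (crossing_number (path_pair \<sigma>)) \<ge> ereal (c * (real L)\<^sup>2)})
          \<longlonglongrightarrow> 1)"
proof -
  let ?bad = "bad_orderings (1 / 1000)"
  define good where "good L = {\<sigma>. ereal (1 / 10 ^ 12 * (real L)\<^sup>2) \<le> ereal_of_enat (crossing_number (path_pair \<sigma>))}" for L
  have set: "set_pmf (random_ordering L) = permutations_of_set {..<L}" for L
    unfolding random_ordering_def by (rule set_pmf_of_set) (auto simp: permutations_of_set_empty_iff)
  have lower: "1 - exp (- (1 / 10) * real L) \<le> measure_pmf.prob (random_ordering L) (good L)"
    if L: "L \<ge> 10 ^ 12" for L
  proof -
    have "1 - exp (- (1 / 10) * real L) \<le> 1 - measure_pmf.prob (random_ordering L) (?bad L)"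
      using prob_bad_orderings_less[of L] L by simp
    also have "\<dots> = measure_pmf.prob (random_ordering L) (- ?bad L)"
      using measure_pmf.prob_compl[of "?bad L" "random_ordering L"] by (simp add: Compl_eq_Diff_UNIV)
    also have "\<dots> \<le> measure_pmf.prob (random_ordering L) (good L)"
    \<comment> \<open>\<open>large_crossing_number\<close> speaks of permutations, so the inclusion
      is asserted on the support only.\<close>
    proof (rule measure_pmf.finite_measure_mono_AE)
      show "AE \<sigma> in measure_pmf (random_ordering L). \<sigma> \<in> - ?bad L \<longrightarrow> \<sigma> \<in> good L"
        using large_crossing_number L by (auto simp: AE_measure_pmf_iff set good_def)
    qed simp
    finally show ?thesis .
  qed
  have "(\<lambda>L. 1 - exp (- (1 / 10) * real L)) \<longlonglongrightarrow> 1" by real_asymp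
  then have "(\<lambda>L. measure_pmf.prob (random_ordering L) (good L)) \<longlonglongrightarrow> 1"
  proof (rule tendsto_sandwich[rotated 2, OF _ tendsto_const])
    show "\<forall>\<^sub>F L in sequentially. 1 - exp (- (1 / 10) * real L) \<le> measure_pmf.prob (random_ordering L) (good L)"
      by (rule eventually_sequentiallyI) (rule lower)
  qed simp
  moreover have "\<forall>\<^sub>F L in sequentially. \<exists>\<sigma>\<in>permutations_of_set {..<L}. \<sigma> \<in> good L"
  proof (rule eventually_sequentiallyI[of "10 ^ 12"])
    fix L :: nat assume L: "10 ^ 12 \<le> L"
    have "0 < 1 - exp (- (1 / 10) * real L)" using L by simp
    then have "measure_pmf.prob (random_ordering L) (good L) \<noteq> 0" using lower[OF L] by linarith
    then have "set_pmf (random_ordering L) \<inter> good L \<noteq> {}" by (simp add: measure_pmf_zero_iff)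
    then show "\<exists>\<sigma>\<in>permutations_of_set {..<L}. \<sigma> \<in> good L" using set by auto
  qed
  ultimately show ?thesis
    using prob_bad_orderings_less
    by (intro exI[of _ "1 / 1000"] conjI exI[of _ "100 :: nat"] exI[of _ "1 / 10"] exI[of _ "1 / 10 ^ 12"])
      (auto simp: good_def bad_orderings_def)
qed

end
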